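(* The group $SL_3(\mathbb{Z})$ does not admit any nontrivial normal subgroup with the Haagerup property.
   Context: A (discrete countable) group $G$ has the Haagerup property if there is a sequence of positive-definite functions in $c_0(G)$ converging pointwise to $1$. A subgroup $H$ of $G$ is called nontrivial if $\{e\}\neq H\neq G$. *)

theory Defs
  imports "HOL-Analysis.Analysis" "HOL-Algebra.Coset"
begin

definition SL :: "('a::comm_ring_1 ^ 'n ^ 'n) monoid"
  where "SL = \<lparr>carrier = {A. det A = 1}, mult = (**), one = mat 1\<rparr>"

text \<open>Sums over a finite set of pairwise distinct group elements suffice: in a finite family
  with repetitions, the coefficients belonging to equal elements can be added up.\<close>

definition positive_definite_on :: "('a, 'b) monoid_scheme \<Rightarrow> ('a \<Rightarrow> complex) \<Rightarrow> bool"
  where "positive_definite_on G \<phi> \<longleftrightarrow>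
    (\<forall>F c. finite F \<longrightarrow> F \<subseteq> carrier G \<longrightarrow>
      (\<Sum>g\<in>F. \<Sum>h\<in>F. cnj (c g) * c h * \<phi> (inv\<^bsub>G\<^esub> g \<otimes>\<^bsub>G\<^esub> h)) \<in> \<real>\<^sub>\<ge>\<^sub>0)"

definition c0_on :: "'a set \<Rightarrow> ('a \<Rightarrow> complex) \<Rightarrow> bool"
  where "c0_on S \<phi> \<longleftrightarrow> (\<forall>\<epsilon>>0. finite {g \<in> S. cmod (\<phi> g) \<ge> \<epsilon>})"

text \<open>Countability of the discrete group is not required separately: each function in
  \<open>c\<^sub>0\<close> has countable support, and pointwise convergence to 1 forces every group element
  into one of these supports.\<close>

definition Haagerup_property :: "('a, 'b) monoid_scheme \<Rightarrow> bool"
  where "Haagerup_property G \<longleftrightarrow>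
    (\<exists>\<phi> :: nat \<Rightarrow> 'a \<Rightarrow> complex.
      (\<forall>n. positive_definite_on G (\<phi> n) \<and> c0_on (carrier G) (\<phi> n)) \<and>
      (\<forall>g\<in>carrier G. (\<lambda>n. \<phi> n g) \<longlonglongrightarrow> 1))"

definition nontrivial_subgroup :: "'a set \<Rightarrow> ('a, 'b) monoid_scheme \<Rightarrow> bool"
  where "nontrivial_subgroup H G \<longleftrightarrow> subgroup H G \<and> H \<noteq> {\<one>\<^bsub>G\<^esub>} \<and> H \<noteq> carrier G"

lemma SL3_group: "group (SL :: ('a::comm_ring_1 ^ 3 ^ 3) monoid)"
proof (rule groupI)
  fix x :: "'a^3^3" assume "x \<in> carrier SL"
  then have d: "det x = 1" by (simp add: SL_def)
  define y :: "'a^3^3" where "y = vector [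
     vector [x$2$2 * x$3$3 - x$2$3 * x$3$2, x$1$3 * x$3$2 - x$1$2 * x$3$3, x$1$2 * x$2$3 - x$1$3 * x$2$2],
     vector [x$2$3 * x$3$1 - x$2$1 * x$3$3, x$1$1 * x$3$3 - x$1$3 * x$3$1, x$1$3 * x$2$1 - x$1$1 * x$2$3],
     vector [x$2$1 * x$3$2 - x$2$2 * x$3$1, x$1$2 * x$3$1 - x$1$1 * x$3$2, x$1$1 * x$2$2 - x$1$2 * x$2$1]]"
  have yx: "y ** x = mat 1"
    using d unfolding det_3
    by (simp add: y_def vec_eq_iff forall_3 matrix_matrix_mult_def sum_3 mat_def algebra_simps)
  have "det (y ** x) = det y * det x" by (rule det_mul)
  then have "det y = 1" using yx d by simp
  then show "\<exists>y\<in>carrier SL. y \<otimes>\<^bsub>SL\<^esub> x = \<one>\<^bsub>SL\<^esub>"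
    using yx by (auto simp: SL_def)
qed (auto simp: SL_def det_mul matrix_mul_assoc)

end

theory Submission
  imports Defs
begin

text \<open>
  Let \<open>H\<close> be a nontrivial normal subgroup of \<open>SL\<^sub>3(\<int>)\<close>. Double commutators with transvections
  show that \<open>H\<close> contains, for some \<open>N > 0\<close>, the \<open>N\<close>-th powers of the elementary matrices, hence a copy
  \<open>\<tau>\<close> of \<open>\<int>\<^sup>2\<close> on which two elements of \<open>H\<close> act by the shears
  \<open>(p, q) \<mapsto> (p, q + N p)\<close> and \<open>(p, q) \<mapsto> (p + N q, q)\<close>.

  Let \<open>\<phi>\<close> be a positive definite function on \<open>H\<close> close to 1 on finitely many elements. It suffices to show
  that \<open>\<psi> = \<phi> \<circ> \<tau>\<close> is not in \<open>c\<^sub>0\<close> (relative property (T)). In place of the spectral measure of \<open>\<psi>\<close>,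
  consider the linear functional on trigonometric polynomials sending the character \<open>v\<close> to \<open>\<psi> v\<close>. By
  Fejer summation it is nonnegative on nonnegative polynomials, and since \<open>\<phi>\<close> is close to 1 at the shears it
  is almost invariant under them. Put \<open>X = |1 - z|\<^sup>2\<close> and \<open>Y = |1 - w|\<^sup>2\<close>. If \<open>\<psi>\<close> were in \<open>c\<^sub>0\<close>, there would be
  no mass at the origin, so polynomials \<open>f\<close> and \<open>h\<close> approximating
  \<open>X / (X + Y)\<close> and \<open>Y / (X + Y)\<close> from below would have total integral almost 1. But the sum of the three
  translates of \<open>h\<close> by the shear \<open>z \<mapsto> z w\<^sup>k\<close>, \<open>k = -N, 0, N\<close>, is at most \<open>7/5\<close> up to a multiple of \<open>Y\<close>, because
  at most one of the three points \<open>z w\<^sup>k\<close> is nearer to 1 than \<open>2 |1 - w|\<close>; likewise for \<open>f\<close>. Almost invariance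
  then gives \<open>3 \<le> 14/5\<close> up to a small error.
\<close>

section \<open>Trigonometric polynomials on the two-dimensional torus\<close>

text \<open>The summands form a geometric progression with ratio \<open>q\<close>. The bound on
  \<open>a\<close> keeps \<open>q\<close> away from 1 unless \<open>a = 0\<close>, and then
  \<open>q ^ M = 1\<close> makes the sum vanish.\<close>

lemma root_of_unity_sum:
  fixes a :: int
  assumes "\<bar>a\<bar> < int M"
  shows "(\<Sum>j<M. cis (2 * pi * real j / real M) powi a) = (if a = 0 then of_nat M else 0)"
proof (cases "a = 0")
  case False
  have M: "M > 0" using assms by auto
  define q where "q = cis (2 * pi * real_of_int a / real M)"
  have "cis (2 * pi * real j / real M) powi a = q ^ j" for j
    unfolding q_def cis_power_int Complex.DeMoivre by (rule arg_cong[of _ _ cis]) (simp add: mult_ac)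
  moreover have "q \<noteq> 1"
  proof
    assume "q = 1"
    then have "cos (2 * pi * real_of_int a / real M) = 1"
      by (simp add: q_def complex_eq_iff)
    then obtain k :: int where "2 * pi * real_of_int a / real M = real_of_int k * 2 * pi"
      by (auto simp: cos_one_2pi_int)
    then have "real_of_int a = real_of_int (k * int M)"
      using M by (simp add: field_simps)
    then have "a = k * int M" by linarith
    then show False using assms False M
      by (auto simp: abs_mult)
  qed
  moreover have "q ^ M = 1"
  proof -
    have "q ^ M = cis (real M * (2 * pi * real_of_int a / real M))"
      unfolding q_def Complex.DeMoivre ..
    also have "real M * (2 * pi * real_of_int a / real M) = 2 * pi * real_of_int a"
      using M by simp
    also have "cis \<dots> = 1" by (rule cis_multiple_2pi) simp
    finally show ?thesis .
  qed
  ultimately show ?thesis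
    using False by (simp add: geometric_sum)
qed auto

text \<open>An entry \<open>(c, p, q)\<close> stands for the monomial \<open>c z\<^sup>p w\<^sup>q\<close>; exponents may repeat, so that sums are
  concatenations.\<close>

type_synonym trig_list = "(complex \<times> int \<times> int) list"

definition trig_eval :: "trig_list \<Rightarrow> complex \<Rightarrow> complex \<Rightarrow> complex" where
  "trig_eval xs z w = (\<Sum>(c, p, q)\<leftarrow>xs. c * (z powi p * w powi q))"

definition trig_apply :: "(int \<times> int \<Rightarrow> complex) \<Rightarrow> trig_list \<Rightarrow> complex" where
  "trig_apply \<psi> xs = (\<Sum>(c, v)\<leftarrow>xs. c * \<psi> v)"

definition pos_def_Z2 :: "(int \<times> int \<Rightarrow> complex) \<Rightarrow> bool" where
  "pos_def_Z2 \<psi> \<longleftrightarrow>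
    (\<forall>F c. finite F \<longrightarrow> (\<Sum>u\<in>F. \<Sum>v\<in>F. cnj (c u) * c v * \<psi> (v - u)) \<in> \<real>\<^sub>\<ge>\<^sub>0)"

definition represents :: "trig_list \<Rightarrow> (complex \<Rightarrow> complex \<Rightarrow> real) \<Rightarrow> bool" where
  "represents xs F \<longleftrightarrow>
    (\<forall>z w. cmod z = 1 \<longrightarrow> cmod w = 1 \<longrightarrow> trig_eval xs z w = of_real (F z w))"

section \<open>Fejer summation and positivity of the functional\<close>

definition fejer_sum :: "(int \<times> int \<Rightarrow> complex) \<Rightarrow> nat \<Rightarrow> complex \<Rightarrow> complex \<Rightarrow> complex" where
  "fejer_sum \<psi> N z w =
    (\<Sum>u\<in>{0..<int N}\<times>{0..<int N}. \<Sum>v\<in>{0..<int N}\<times>{0..<int N}.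
       z powi (fst u - fst v) * w powi (snd u - snd v) * \<psi> (v - u))"

lemma sum_in_nonneg_Reals:
  fixes f :: "'a \<Rightarrow> complex"
  assumes "\<And>x. x \<in> A \<Longrightarrow> f x \<in> \<real>\<^sub>\<ge>\<^sub>0"
  shows "sum f A \<in> \<real>\<^sub>\<ge>\<^sub>0"
  using assms by (induction A rule: infinite_finite_induct) auto

text \<open>With \<open>c\<close> the conjugate character, \<open>fejer_sum\<close> is the quadratic
  form of positive definiteness. Collecting equal differences \<open>s = v - u\<close> shows that it
  is also \<open>N ^ 2\<close> times a Fejer mean of the series with coefficients
  \<open>\<psi> s\<close>.\<close>

lemma fejer_sum_nonneg:
  assumes "pos_def_Z2 \<psi>" "cmod z = 1" "cmod w = 1"
  shows "fejer_sum \<psi> N z w \<in> \<real>\<^sub>\<ge>\<^sub>0"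
proof -
  define c where "c v = z powi (- fst v) * w powi (- snd v)" for v :: "int \<times> int"
  have nz: "z \<noteq> 0" "w \<noteq> 0" using assms by auto
  have cnj_eq: "cnj x = inverse x" if "cmod x = 1" for x
    using that by (metis complex_div_cnj divide_inverse_commute mult_1_right of_real_1 power_one
        inverse_eq_divide complex_cnj_one div_by_1 mult_1)
  have "cnj (c u) * c v = z powi (fst u - fst v) * w powi (snd u - snd v)" for u v
    using nz assms by (simp add: c_def cnj_eq power_int_diff power_int_minus field_simps)
  then have "fejer_sum \<psi> N z w = (\<Sum>u\<in>{0..<int N}\<times>{0..<int N}. \<Sum>v\<in>{0..<int N}\<times>{0..<int N}.
       cnj (c u) * c v * \<psi> (v - u))"
    by (simp add: fejer_sum_def)
  also have "\<dots> \<in> \<real>\<^sub>\<ge>\<^sub>0"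
    using assms(1) by (simp add: pos_def_Z2_def)
  finally show ?thesis .
qed

lemma card_overlap:
  assumes "\<bar>a\<bar> \<le> int N"
  shows "card {u\<in>{0..<int N}. u + a \<in> {0..<int N}} = nat (int N - \<bar>a\<bar>)"
proof -
  have "{u\<in>{0..<int N}. u + a \<in> {0..<int N}} = {max 0 (- a)..<min (int N) (int N - a)}"
    by auto
  then show ?thesis using assms by (simp add: min_def max_def abs_if)
qed

text \<open>Integration over the torus is replaced by summation over a grid of
  \<open>2 * N\<close>-th roots of unity. All exponents \<open>s + u - v\<close> have components
  below \<open>2 * N\<close> in absolute value, so the discrete orthogonality relations are exact.
  What remains is the number of pairs in the box with difference \<open>s\<close>.\<close>

lemma fejer_moment:
  fixes s :: "int \<times> int"
  assumes s: "\<bar>fst s\<bar> \<le> int N" "\<bar>snd s\<bar> \<le> int N"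
  defines "\<zeta> \<equiv> \<lambda>j. cis (2 * pi * real j / real (2 * N))"
  shows "(\<Sum>j<2*N. \<Sum>k<2*N. (\<zeta> j powi fst s * \<zeta> k powi snd s) * fejer_sum \<psi> N (\<zeta> j) (\<zeta> k))
    = of_nat (2 * N) ^ 2 * of_int ((int N - \<bar>fst s\<bar>) * (int N - \<bar>snd s\<bar>)) * \<psi> s"
proof -
  define I where "I = {0..<int N}"
  let ?B = "I \<times> I"
  let ?M = "2 * N"
  have nz: "\<zeta> j \<noteq> 0" for j by (simp add: \<zeta>_def)
  have sm: "(\<Sum>j<?M. \<zeta> j powi a) = (if a = 0 then of_nat ?M else 0)" if "\<bar>a\<bar> < int ?M" for a
    unfolding \<zeta>_def by (rule root_of_unity_sum) (use that in simp)
  have "(\<Sum>j<?M. \<Sum>k<?M. (\<zeta> j powi fst s * \<zeta> k powi snd s) * fejer_sum \<psi> N (\<zeta> j) (\<zeta> k))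
     = (\<Sum>j<?M. \<Sum>k<?M. \<Sum>u\<in>?B. \<Sum>v\<in>?B. \<zeta> j powi (fst s + (fst u - fst v)) * \<zeta> k powi (snd s + (snd u - snd v)) * \<psi> (v - u))"
    unfolding fejer_sum_def sum_distrib_left I_def[symmetric]
    by (intro sum.cong refl) (simp add: power_int_add nz)
  also have "\<dots> = (\<Sum>u\<in>?B. \<Sum>v\<in>?B. \<Sum>j<?M. \<Sum>k<?M. \<zeta> j powi (fst s + (fst u - fst v)) * \<zeta> k powi (snd s + (snd u - snd v)) * \<psi> (v - u))"
    by (simp only: sum.swap[of _ "?B" "{..<?M}"])
  also have "\<dots> = (\<Sum>u\<in>?B. \<Sum>v\<in>?B. (\<Sum>j<?M. \<zeta> j powi (fst s + (fst u - fst v))) *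
       (\<Sum>k<?M. \<zeta> k powi (snd s + (snd u - snd v))) * \<psi> (v - u))"
    unfolding sum_product by (simp only: sum_distrib_right)
  also have "\<dots> = (\<Sum>u\<in>?B. \<Sum>v\<in>?B. if v = u + s then of_nat ?M ^ 2 * \<psi> s else 0)"
  proof (intro sum.cong refl)
    fix u v assume uv: "u \<in> ?B" "v \<in> ?B"
    have 1: "\<bar>fst s + (fst u - fst v)\<bar> < int ?M" and 2: "\<bar>snd s + (snd u - snd v)\<bar> < int ?M"
      using uv s by (auto simp: I_def)
    have "v = u + s \<longleftrightarrow> fst s + (fst u - fst v) = 0 \<and> snd s + (snd u - snd v) = 0"
      by (auto simp: prod_eq_iff)
    then show "(\<Sum>j<?M. \<zeta> j powi (fst s + (fst u - fst v))) *
       (\<Sum>k<?M. \<zeta> k powi (snd s + (snd u - snd v))) * \<psi> (v - u) = (if v = u + s then of_nat ?M ^ 2 * \<psi> s else 0)"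
      unfolding sm[OF 1] sm[OF 2] by (auto simp: power2_eq_square)
  qed
  also have "\<dots> = (\<Sum>u\<in>?B. if u + s \<in> ?B then of_nat ?M ^ 2 * \<psi> s else 0)"
    by (intro sum.cong refl) (simp add: sum.delta' I_def)
  also have "\<dots> = of_nat (card {u\<in>?B. u + s \<in> ?B}) * (of_nat ?M ^ 2 * \<psi> s)"
    by (simp add: sum.If_cases I_def Int_def)
  also have "{u\<in>?B. u + s \<in> ?B} = {u\<in>I. u + fst s \<in> I} \<times> {u\<in>I. u + snd s \<in> I}"
    by (auto simp: mem_Times_iff)
  also have "card \<dots> = nat (int N - \<bar>fst s\<bar>) * nat (int N - \<bar>snd s\<bar>)"
    using card_overlap s by (simp add: card_cartesian_product I_def)
  also have "of_nat \<dots> = (of_int ((int N - \<bar>fst s\<bar>) * (int N - \<bar>snd s\<bar>)) :: complex)"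
    using s by (simp only: of_nat_mult of_int_mult of_nat_nat diff_ge_0_iff_ge)
  finally show ?thesis by (simp add: mult_ac)
qed

text \<open>Summing \<open>F\<close> against the nonnegative Fejer sums over the grid gives a
  nonnegative number. Up to a positive factor it is the value of the functional with each
  coefficient damped by a Fejer weight, and these weights tend to 1.\<close>

theorem trig_apply_nonneg:
  assumes pd: "pos_def_Z2 \<psi>" and rep: "represents xs F"
    and nn: "\<And>z w. cmod z = 1 \<Longrightarrow> cmod w = 1 \<Longrightarrow> F z w \<ge> 0"
  shows "Re (trig_apply \<psi> xs) \<ge> 0"
proof -
  define \<zeta> where "\<zeta> N j = cis (2 * pi * real j / real (2 * N))" for N j :: nat
  \<comment> \<open>The Fejer weight \<open>(1 - |fst s| / N) * (1 - |snd s| / N)\<close>, written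
    over a common denominator.\<close>
  define t where "t N s = (of_int ((int N - \<bar>fst s\<bar>) * (int N - \<bar>snd s\<bar>)) / of_nat N ^ 2 :: complex)"
    for N and s :: "int \<times> int"
  have tlim: "(\<lambda>N. t N s) \<longlonglongrightarrow> 1" for s
  proof -
    have "(\<lambda>N. (1 - of_int \<bar>fst s\<bar> / of_nat N) * (1 - of_int \<bar>snd s\<bar> / of_nat N) :: complex) \<longlonglongrightarrow> (1 - 0) * (1 - 0)"
      by (intro tendsto_intros lim_const_over_n)
    moreover have "\<forall>\<^sub>F N in sequentially. (1 - of_int \<bar>fst s\<bar> / of_nat N) * (1 - of_int \<bar>snd s\<bar> / of_nat N) = t N s"
      using eventually_gt_at_top[of 0]
      by eventually_elim (simp add: t_def field_simps power2_eq_square)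
    ultimately show ?thesis by (simp add: Lim_transform_eventually)
  qed
  have lim: "(\<lambda>N. \<Sum>(c, s)\<leftarrow>xs. c * (t N s * \<psi> s)) \<longlonglongrightarrow> trig_apply \<psi> xs"
    unfolding trig_apply_def
  proof (induction xs)
    case (Cons x xs)
    obtain c s where "x = (c, s)" by (cases x) auto
    moreover have "(\<lambda>N. c * (t N s * \<psi> s)) \<longlonglongrightarrow> c * (1 * \<psi> s)"
      by (intro tendsto_intros tlim)
    ultimately show ?case using Cons by (auto intro: tendsto_add)
  qed auto
  \<comment> \<open>\<open>fejer_moment\<close> applies to every monomial of \<open>xs\<close> once
    \<open>N\<close> is at least as large as all exponents.\<close>
  have "\<forall>\<^sub>F N in sequentially. \<forall>x\<in>set xs. \<bar>fst (snd x)\<bar> \<le> int N \<and> \<bar>snd (snd x)\<bar> \<le> int N"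
  proof (intro eventually_ball_finite ballI)
    fix x :: "complex \<times> int \<times> int"
    show "\<forall>\<^sub>F N in sequentially. \<bar>fst (snd x)\<bar> \<le> int N \<and> \<bar>snd (snd x)\<bar> \<le> int N"
      using eventually_ge_at_top[of "nat (max \<bar>fst (snd x)\<bar> \<bar>snd (snd x)\<bar>)"]
      by eventually_elim auto
  qed auto
  then have "\<forall>\<^sub>F N in sequentially. Re (\<Sum>(c, s)\<leftarrow>xs. c * (t N s * \<psi> s)) \<ge> 0"
    using eventually_gt_at_top[of 0]
  proof eventually_elim
    case (elim N)
    define S where "S = (\<Sum>j<2*N. \<Sum>k<2*N. trig_eval xs (\<zeta> N j) (\<zeta> N k) * fejer_sum \<psi> N (\<zeta> N j) (\<zeta> N k))"
    have S: "S \<in> \<real>\<^sub>\<ge>\<^sub>0"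
      unfolding S_def
      by (intro sum_in_nonneg_Reals nonneg_Reals_mult_I)
        (use rep nn fejer_sum_nonneg[OF pd] in \<open>auto simp: represents_def \<zeta>_def\<close>)
    have "S = of_nat (2 * N) ^ 2 * of_nat N ^ 2 * (\<Sum>(c, s)\<leftarrow>xs. c * (t N s * \<psi> s))"
      unfolding S_def trig_eval_def using elim(1)
    proof (induction xs)
      case (Cons x xs)
      obtain c s where x: "x = (c, s)" by (cases x) auto
      have "(\<Sum>j<2*N. \<Sum>k<2*N. c * ((\<zeta> N j powi fst s * \<zeta> N k powi snd s) * fejer_sum \<psi> N (\<zeta> N j) (\<zeta> N k)))
         = c * (of_nat (2 * N) ^ 2 * of_int ((int N - \<bar>fst s\<bar>) * (int N - \<bar>snd s\<bar>)) * \<psi> s)"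
        unfolding sum_distrib_left[symmetric] \<zeta>_def
        using Cons.prems by (subst fejer_moment) (auto simp: x)
      also have "\<dots> = of_nat (2 * N) ^ 2 * of_nat N ^ 2 * (c * (t N s * \<psi> s))"
        using elim(2) by (simp add: t_def field_simps)
      finally show ?case
        using Cons by (simp add: x case_prod_unfold ring_distribs sum.distrib mult.assoc)
    qed simp
    also have "(of_nat (2 * N) ^ 2 * of_nat N ^ 2 :: complex) = of_real (real (2 * N) ^ 2 * real N ^ 2)"
      by simp
    finally have "Re S = (real (2 * N) ^ 2 * real N ^ 2) * Re (\<Sum>(c, s)\<leftarrow>xs. c * (t N s * \<psi> s))"
      by (simp only: times_complex.sel Re_complex_of_real Im_complex_of_real mult_zero_left diff_zero)
    moreover have "Re S \<ge> 0" using S by (simp add: complex_nonneg_Reals_iff)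
    moreover have "real (2 * N) ^ 2 * real N ^ 2 > 0" using elim(2) by simp
    ultimately show ?case by (simp only: zero_le_mult_iff) linarith
  qed
  then show ?thesis
    by (intro tendsto_lowerbound[OF tendsto_Re[OF lim]]) auto
qed

section \<open>Algebra of trigonometric polynomials\<close>

lemma trig_eval_append: "trig_eval (xs @ ys) z w = trig_eval xs z w + trig_eval ys z w"
  by (simp add: trig_eval_def)

lemma trig_apply_append: "trig_apply \<psi> (xs @ ys) = trig_apply \<psi> xs + trig_apply \<psi> ys"
  by (simp add: trig_apply_def)

definition trig_scale :: "complex \<Rightarrow> trig_list \<Rightarrow> trig_list" where
  "trig_scale a xs = map (\<lambda>(c, v). (a * c, v)) xs"

lemma trig_eval_scale: "trig_eval (trig_scale a xs) z w = a * trig_eval xs z w"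
  unfolding trig_eval_def trig_scale_def by (induction xs) (auto simp: algebra_simps)

lemma trig_apply_scale: "trig_apply \<psi> (trig_scale a xs) = a * trig_apply \<psi> xs"
  unfolding trig_apply_def trig_scale_def by (induction xs) (auto simp: algebra_simps)

definition trig_mult ::
  "trig_list \<Rightarrow> trig_list \<Rightarrow> trig_list" where
  "trig_mult xs ys = concat (map (\<lambda>(c, u). map (\<lambda>(d, v). (c * d, u + v)) ys) xs)"

lemma trig_eval_mult:
  assumes "z \<noteq> 0" "w \<noteq> 0"
  shows "trig_eval (trig_mult xs ys) z w = trig_eval xs z w * trig_eval ys z w"
proof (induction xs)
  case Nil
  show ?case by (simp add: trig_mult_def trig_eval_def)
next
  case (Cons x xs)
  obtain c p q where x: "x = (c, p, q)" by (cases x) auto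
  have "trig_eval (map (\<lambda>(d, v). (c * d, (p, q) + v)) ys) z w = c * (z powi p * w powi q) * trig_eval ys z w"
    unfolding trig_eval_def
    by (induction ys) (auto simp: algebra_simps power_int_add assms)
  moreover have "trig_mult (x # xs) ys = map (\<lambda>(d, v). (c * d, (p, q) + v)) ys @ trig_mult xs ys"
    by (simp add: trig_mult_def x)
  ultimately show ?case
    using Cons by (simp add: trig_eval_append) (simp add: trig_eval_def x algebra_simps)
qed

text \<open>Which list is chosen does not matter: by \<open>trig_apply_mono\<close>, used in both
  directions, lists representing the same function give \<open>trig_apply\<close> the same real part
  when \<open>\<psi>\<close> is positive definite.\<close>

definition trig_poly :: "(complex \<Rightarrow> complex \<Rightarrow> real) \<Rightarrow> bool" where
  "trig_poly F \<longleftrightarrow> (\<exists>xs. represents xs F)"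

lemma represents_add:
  "represents xs F \<Longrightarrow> represents ys G \<Longrightarrow> represents (xs @ ys) (\<lambda>z w. F z w + G z w)"
  by (simp add: represents_def trig_eval_append)

lemma represents_scale:
  "represents xs F \<Longrightarrow> represents (trig_scale (of_real a) xs) (\<lambda>z w. a * F z w)"
  by (simp add: represents_def trig_eval_scale)

lemma represents_const: "represents [(of_real a, 0, 0)] (\<lambda>z w. a)"
  by (simp add: represents_def trig_eval_def)

lemma trig_poly_const: "trig_poly (\<lambda>z w. a)"
  using represents_const trig_poly_def by blast

lemma trig_poly_add: "trig_poly F \<Longrightarrow> trig_poly G \<Longrightarrow> trig_poly (\<lambda>z w. F z w + G z w)"
  using represents_add trig_poly_def by blast

lemma trig_poly_mult:
  assumes "trig_poly F" "trig_poly G"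
  shows "trig_poly (\<lambda>z w. F z w * G z w)"
proof -
  obtain xs ys where *: "represents xs F" "represents ys G"
    using assms by (auto simp: trig_poly_def)
  have "represents (trig_mult xs ys) (\<lambda>z w. F z w * G z w)"
    unfolding represents_def
  proof (intro allI impI)
    fix z w :: complex assume 1: "cmod z = 1" "cmod w = 1"
    then have "z \<noteq> 0" "w \<noteq> 0" by auto
    then show "trig_eval (trig_mult xs ys) z w = of_real (F z w * G z w)"
      using * 1 by (simp add: trig_eval_mult represents_def)
  qed
  then show ?thesis by (auto simp: trig_poly_def)
qed

lemma trig_poly_diff:
  assumes "trig_poly F" "trig_poly G"
  shows "trig_poly (\<lambda>z w. F z w - G z w)"
  using trig_poly_add[OF assms(1) trig_poly_mult[OF trig_poly_const[of "-1"] assms(2)]] by simp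

lemma trig_poly_power: "trig_poly F \<Longrightarrow> trig_poly (\<lambda>z w. F z w ^ k)"
  by (induction k) (auto intro: trig_poly_const trig_poly_mult)

lemma trig_poly_sum:
  "(\<And>i. i \<in> A \<Longrightarrow> trig_poly (F i)) \<Longrightarrow> trig_poly (\<lambda>z w. \<Sum>i\<in>A. F i z w)"
  by (induction A rule: infinite_finite_induct) (auto intro: trig_poly_const trig_poly_add)

lemma cnj_eq_inverse: "cmod z = 1 \<Longrightarrow> cnj z = inverse z"
  by (metis complex_norm_square inverse_unique mult.commute of_real_1 one_power2)

lemma cmod_one_minus_sq:
  assumes "cmod z = 1"
  shows "(of_real (cmod (1 - z)))\<^sup>2 = 2 - z - inverse z"
proof -
  have "z \<noteq> 0" using assms by auto
  have "(of_real (cmod (1 - z)))\<^sup>2 = (1 - z) * (1 - inverse z)"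
    unfolding of_real_power[symmetric] complex_norm_square by (simp add: cnj_eq_inverse assms)
  also have "\<dots> = 2 - z - inverse z"
    using \<open>z \<noteq> 0\<close> by (simp add: algebra_simps)
  finally show ?thesis .
qed

lemma represents_X:
  "represents [(2, 0, 0), (-1, 1, 0), (-1, -1, 0)] (\<lambda>z w. (cmod (1 - z))\<^sup>2)"
  unfolding represents_def trig_eval_def by (auto simp: cmod_one_minus_sq)

lemma represents_Y:
  "represents [(2, 0, 0), (-1, 0, 1), (-1, 0, -1)] (\<lambda>z w. (cmod (1 - w))\<^sup>2)"
  unfolding represents_def trig_eval_def by (auto simp: cmod_one_minus_sq)

section \<open>Monotonicity, almost invariance and shears\<close>

lemma trig_apply_mono:
  assumes "pos_def_Z2 \<psi>" "represents xs F" "represents ys G"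
    and "\<And>z w. cmod z = 1 \<Longrightarrow> cmod w = 1 \<Longrightarrow> F z w \<le> G z w"
  shows "Re (trig_apply \<psi> xs) \<le> Re (trig_apply \<psi> ys)"
proof -
  have "represents (ys @ trig_scale (of_real (- 1)) xs) (\<lambda>z w. G z w + (- 1) * F z w)"
    by (intro represents_add represents_scale assms)
  from trig_apply_nonneg[OF assms(1) this] show ?thesis
    using assms(4) by (simp add: trig_apply_append trig_apply_scale)
qed

lemma trig_apply_combination:
  "trig_apply (\<lambda>v. a * \<psi>1 v + b * \<psi>2 v + c * \<psi>3 v) xs =
    a * trig_apply \<psi>1 xs + b * trig_apply \<psi>2 xs + c * trig_apply \<psi>3 xs"
  unfolding trig_apply_def by (induction xs) (auto simp: algebra_simps)

text \<open>If \<open>\<psi>\<close>, \<open>\<psi>'\<close> and \<open>\<kappa>\<close> are the coefficients of \<open>\<xi>\<close>, those of \<open>\<gamma> \<xi>\<close> and the mixed ones, the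
  hypothesis is positivity at all vectors \<open>\<alpha> \<gamma> \<xi> + \<beta> \<xi>\<close>. It is used for \<open>F\<close> at \<open>(1 + t) \<gamma> \<xi> - \<xi>\<close> with
  \<open>t = 1/20\<close> and for \<open>1 - F\<close> at \<open>\<gamma> \<xi> - \<xi>\<close>; no operator norm is needed.\<close>

lemma almost_invariance:
  assumes pd: "\<And>\<alpha> \<beta> :: real. pos_def_Z2 (\<lambda>v. of_real (\<alpha>\<^sup>2) * \<psi>' v + of_real (\<beta>\<^sup>2) * \<psi> v + of_real (\<alpha> * \<beta>) * \<kappa> v)"
    and rep: "represents xs F"
    and F: "\<And>z w. cmod z = 1 \<Longrightarrow> cmod w = 1 \<Longrightarrow> 0 \<le> F z w \<and> F z w \<le> 1"
  shows "Re (trig_apply \<psi> xs) \<le> 21/20 * Re (trig_apply \<psi>' xs) + 21 * Re (\<psi>' 0 + \<psi> 0 - \<kappa> 0)"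
proof -
  have 1: "0 \<le> Re (trig_apply (\<lambda>v. of_real ((21/20)\<^sup>2) * \<psi>' v + of_real ((-1)\<^sup>2) * \<psi> v + of_real (21/20 * (-1)) * \<kappa> v) xs)"
    by (rule trig_apply_nonneg[OF pd rep]) (use F in blast)
  have 2: "represents ([(of_real 1, 0, 0)] @ trig_scale (of_real (-1)) xs) (\<lambda>z w. 1 + (-1) * F z w)"
    by (intro represents_add represents_scale represents_const rep)
  have 3: "0 \<le> Re (trig_apply (\<lambda>v. of_real (1\<^sup>2) * \<psi>' v + of_real ((-1)\<^sup>2) * \<psi> v + of_real (1 * (-1)) * \<kappa> v)
     ([(of_real 1, 0, 0)] @ trig_scale (of_real (-1)) xs))"
    by (rule trig_apply_nonneg[OF pd 2]) (use F in auto)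
  have 4: "trig_apply f [(1, 0, 0)] = f 0" for f
    by (simp add: trig_apply_def zero_prod_def)
  have "441/400 * Re (trig_apply \<psi>' xs) + Re (trig_apply \<psi> xs) - 21/20 * Re (trig_apply \<kappa> xs) \<ge> 0"
    using 1 unfolding trig_apply_combination by (simp add: power2_eq_square)
  moreover have "Re (\<psi>' 0 + \<psi> 0 - \<kappa> 0) - Re (trig_apply \<psi>' xs) - Re (trig_apply \<psi> xs) + Re (trig_apply \<kappa> xs) \<ge> 0"
    using 3 unfolding trig_apply_append trig_apply_scale
    unfolding trig_apply_combination by (simp add: 4 algebra_simps)
  \<comment> \<open>Adding 21/20 times the second inequality to the first cancels the mixed term
    \<open>\<kappa>\<close> and leaves 1/20 of the claim.\<close>
  ultimately show ?thesis by (simp add: field_simps)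
qed

text \<open>A shear of the torus acts on characters by a shear of the exponents. Together with
  \<open>trig_apply_shear1\<close> this turns the sheared functional at \<open>F\<close> into the
  original functional at a translate of \<open>F\<close>.\<close>

lemma represents_shear1:
  assumes "represents xs F"
  shows "represents (map (\<lambda>(c, p, q). (c, p, q + k * p)) xs) (\<lambda>z w. F (z * w powi k) w)"
  unfolding represents_def
proof (intro allI impI)
  fix z w :: complex assume 1: "cmod z = 1" "cmod w = 1"
  then have "z \<noteq> 0" "w \<noteq> 0" by auto
  then have "trig_eval (map (\<lambda>(c, p, q). (c, p, q + k * p)) xs) z w = trig_eval xs (z * w powi k) w"
    unfolding trig_eval_def
    by (induction xs) (auto simp: power_int_add power_int_mult_distrib power_int_mult)
  also have "\<dots> = of_real (F (z * w powi k) w)"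
    using assms 1 by (auto simp: represents_def norm_mult norm_power_int)
  finally show "trig_eval (map (\<lambda>(c, p, q). (c, p, q + k * p)) xs) z w = of_real (F (z * w powi k) w)" .
qed

lemma represents_shear2:
  assumes "represents xs F"
  shows "represents (map (\<lambda>(c, p, q). (c, p + k * q, q)) xs) (\<lambda>z w. F z (w * z powi k))"
  unfolding represents_def
proof (intro allI impI)
  fix z w :: complex assume 1: "cmod z = 1" "cmod w = 1"
  then have "z \<noteq> 0" "w \<noteq> 0" by auto
  then have "trig_eval (map (\<lambda>(c, p, q). (c, p + k * q, q)) xs) z w = trig_eval xs z (w * z powi k)"
    unfolding trig_eval_def
    by (induction xs) (auto simp: power_int_add power_int_mult_distrib power_int_mult)
  also have "\<dots> = of_real (F z (w * z powi k))"
    using assms 1 by (auto simp: represents_def norm_mult norm_power_int)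
  finally show "trig_eval (map (\<lambda>(c, p, q). (c, p + k * q, q)) xs) z w = of_real (F z (w * z powi k))" .
qed

lemma trig_apply_shear1:
  "trig_apply \<psi> (map (\<lambda>(c, p, q). (c, p, q + k * p)) xs) = trig_apply (\<lambda>(p, q). \<psi> (p, q + k * p)) xs"
  unfolding trig_apply_def by (induction xs) auto

lemma trig_apply_shear2:
  "trig_apply \<psi> (map (\<lambda>(c, p, q). (c, p + k * q, q)) xs) = trig_apply (\<lambda>(p, q). \<psi> (p + k * q, q)) xs"
  unfolding trig_apply_def by (induction xs) auto

section \<open>Approximation of the reciprocal and the three translates\<close>

text \<open>The truncated geometric series of \<open>1 / t = (1/8) / (1 - (1 - t/8))\<close>, where \<open>t = X + Y\<close> ranges over \<open>[0, 8]\<close>.\<close>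

definition geom_poly :: "nat \<Rightarrow> real \<Rightarrow> real" where
  "geom_poly m t = (\<Sum>k\<le>m. (1 - t / 8) ^ k / 8)"

lemma mult_geom_poly: "t * geom_poly m t = 1 - (1 - t / 8) ^ Suc m"
  unfolding geom_poly_def by (induction m) (auto simp: algebra_simps)

lemma geom_poly_bounds:
  assumes "0 \<le> t" "t \<le> 8"
  shows "0 \<le> geom_poly m t" "t * geom_poly m t \<le> 1"
proof -
  show "0 \<le> geom_poly m t"
    unfolding geom_poly_def by (intro sum_nonneg) (use assms in auto)
  have "0 \<le> (1 - t / 8) ^ Suc m" using assms by (intro zero_le_power) auto
  then show "t * geom_poly m t \<le> 1" by (simp add: mult_geom_poly)
qed

text \<open>By Bernoulli, \<open>Suc m * s\<close> is at most \<open>(1 + s) ^ Suc m\<close>, and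
  \<open>(1 + s) * (1 - s)\<close> is at most 1. The bound controls the defect of
  \<open>geom_poly\<close> uniformly in \<open>t\<close>.\<close>

lemma mult_power_one_minus_le:
  fixes s :: real
  assumes "0 \<le> s" "s \<le> 1"
  shows "s * (1 - s) ^ Suc m \<le> 1 / real (Suc m)"
proof -
  have "real (Suc m) * s * (1 - s) ^ Suc m \<le> (1 + real (Suc m) * s) * (1 - s) ^ Suc m"
    using assms by (intro mult_right_mono zero_le_power) auto
  also have "\<dots> \<le> (1 + s) ^ Suc m * (1 - s) ^ Suc m"
    using assms by (intro mult_right_mono Bernoulli_inequality zero_le_power) auto
  also have "\<dots> = (1 - s\<^sup>2) ^ Suc m"
    by (simp only: power_mult_distrib[symmetric]) (simp add: algebra_simps power2_eq_square)
  also have "\<dots> \<le> 1"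
    using assms by (intro power_le_one) (auto simp: power_le_one)
  finally show ?thesis by (simp add: field_simps)
qed

lemma norm_one_minus_power_le:
  fixes w :: complex
  assumes "cmod w = 1"
  shows "cmod (1 - w ^ j) \<le> real j * cmod (1 - w)"
proof (induction j)
  case (Suc j)
  have "1 - w ^ Suc j = (1 - w ^ j) + w ^ j * (1 - w)" by (simp add: algebra_simps)
  then have "cmod (1 - w ^ Suc j) \<le> cmod (1 - w ^ j) + cmod (w ^ j * (1 - w))"
    using norm_triangle_ineq by metis
  also have "cmod (w ^ j * (1 - w)) = cmod (1 - w)" using assms by (simp add: norm_mult norm_power)
  finally show ?case using Suc by (simp add: algebra_simps)
qed auto

text \<open>Factor \<open>1 - w ^ j\<close> as \<open>1 - w\<close> times the geometric sum. Since
  \<open>real j * cmod (1 - w)\<close> is at most 1, the geometric sum stays within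
  \<open>j / 2\<close> of \<open>j\<close>, so its modulus is at least \<open>j / 2\<close>, hence
  at least 4.\<close>

lemma norm_one_minus_power_ge:
  fixes w :: complex
  assumes w: "cmod w = 1" and j: "8 \<le> j" "real j * cmod (1 - w) \<le> 1"
  shows "4 * cmod (1 - w) \<le> cmod (1 - w ^ j)"
proof -
  let ?r = "cmod (1 - w)"
  have "cmod (of_nat j - (\<Sum>i<j. w ^ i)) = cmod (\<Sum>i<j. 1 - w ^ i)"
    by (simp add: sum_subtractf)
  also have "\<dots> \<le> (\<Sum>i<j. real i * ?r)"
    by (intro sum_norm_le norm_one_minus_power_le w)
  also have "\<dots> = (\<Sum>i<j. real i) * ?r"
    by (simp add: sum_distrib_right)
  also have "(\<Sum>i<j. real i) \<le> (real j)\<^sup>2 / 2"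
    by (induction j) (auto simp: power2_eq_square field_simps)
  finally have "cmod (of_nat j - (\<Sum>i<j. w ^ i)) \<le> real j / 2 * (real j * ?r)"
    by (simp add: power2_eq_square mult_right_mono)
  also have "\<dots> \<le> real j / 2" using j by (intro mult_left_le) auto
  finally have "cmod (of_nat j - (\<Sum>i<j. w ^ i)) \<le> real j / 2" .
  moreover have "cmod (of_nat j :: complex) \<le> cmod (of_nat j - (\<Sum>i<j. w ^ i)) + cmod (\<Sum>i<j. w ^ i)"
    by (metis norm_triangle_sub add.commute)
  ultimately have "4 \<le> cmod (\<Sum>i<j. w ^ i)" using j by simp
  then have "4 * ?r \<le> ?r * cmod (\<Sum>i<j. w ^ i)" using mult_left_mono[OF _ norm_ge_zero] by (simp add: mult.commute[of 4])
  also have "\<dots> = cmod (1 - w ^ j)"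
    by (simp add: one_diff_power_eq norm_mult)
  finally show ?thesis .
qed

text \<open>If \<open>w\<close> is close to 1, the three points have mutual distances at least
  \<open>4 * cmod (1 - w)\<close>, so at least two of them are at distance at least
  \<open>2 * cmod (1 - w)\<close> from 1. There \<open>h\<close> is at most 1/5, while it never
  exceeds 1; hence 7/5 = 1 + 1/5 + 1/5.\<close>

lemma three_translates:
  fixes z w :: complex and g :: "real \<Rightarrow> real"
  assumes z: "cmod z = 1" and w: "cmod w = 1" and n: "8 \<le> n"
    and g: "\<And>t. 0 \<le> t \<Longrightarrow> t \<le> 8 \<Longrightarrow> 0 \<le> g t \<and> t * g t \<le> 1"
  defines "Y \<equiv> (cmod (1 - w))\<^sup>2"
  defines "h \<equiv> \<lambda>x. Y * g ((cmod (1 - x))\<^sup>2 + Y)"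
  shows "h z + h (z * w powi int n) + h (z * w powi - int n) \<le> 7/5 + 12 * (real n)\<^sup>2 * Y"
proof -
  let ?r = "cmod (1 - w)" and ?b = "z * w powi int n" and ?c = "z * w powi - int n"
  have le2: "cmod (1 - x) \<le> 2" if "cmod x = 1" for x :: complex
    using norm_triangle_ineq4[of 1 x] that by simp
  have le4: "(cmod (1 - x))\<^sup>2 \<le> 4" if "cmod x = 1" for x :: complex
    using power_mono[OF le2[OF that], of 2] by simp
  have b: "cmod ?b = 1" and c: "cmod ?c = 1"
    using z w by (simp_all add: norm_mult norm_power_int norm_power)
  have bd: "0 \<le> g ((cmod (1 - x))\<^sup>2 + Y) \<and> ((cmod (1 - x))\<^sup>2 + Y) * g ((cmod (1 - x))\<^sup>2 + Y) \<le> 1"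
    if "cmod x = 1" for x :: complex
    by (rule g) (use le4[OF that] le4[OF w] in \<open>auto simp: Y_def\<close>)
  have h1: "h x \<le> 1" if "cmod x = 1" for x
  proof -
    have "h x \<le> ((cmod (1 - x))\<^sup>2 + Y) * g ((cmod (1 - x))\<^sup>2 + Y)"
      unfolding h_def using bd[OF that] by (intro mult_right_mono) auto
    then show ?thesis using bd[OF that] by linarith
  qed
  \<comment> \<open>The 5 is \<open>2 ^ 2 + 1\<close>: at such points \<open>Y\<close> is at most a
    fifth of \<open>(cmod (1 - x))\<^sup>2 + Y\<close>.\<close>
  have h5: "h x \<le> 1/5" if "cmod x = 1" "2 * ?r \<le> cmod (1 - x)" for x
  proof -
    have "(2 * ?r)\<^sup>2 \<le> (cmod (1 - x))\<^sup>2" using that by (intro power_mono) auto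
    then have "5 * Y \<le> (cmod (1 - x))\<^sup>2 + Y" by (simp add: Y_def power2_eq_square)
    then have "5 * Y * g ((cmod (1 - x))\<^sup>2 + Y) \<le> ((cmod (1 - x))\<^sup>2 + Y) * g ((cmod (1 - x))\<^sup>2 + Y)"
      using bd[OF that(1)] by (intro mult_right_mono) auto
    then show ?thesis using bd[OF that(1)] unfolding h_def by linarith
  qed
  show ?thesis
  proof (cases "real (2 * n) * ?r \<le> 1")
    case True
    have Y0: "0 \<le> Y" by (simp add: Y_def)
    have wnz: "w \<noteq> 0" using w by auto
    have d1: "4 * ?r \<le> cmod (1 - w ^ n)"
    proof (rule norm_one_minus_power_ge[OF w n])
      have "real n * ?r \<le> real (2 * n) * ?r" by (intro mult_right_mono) auto
      then show "real n * ?r \<le> 1" using True by linarith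
    qed
    have d2: "4 * ?r \<le> cmod (1 - w ^ (2 * n))"
      by (rule norm_one_minus_power_ge[OF w _ True]) (use n in simp)
    have ab: "cmod (z - ?b) = cmod (1 - w ^ n)"
    proof -
      have "z - ?b = z * (1 - w ^ n)" by (simp add: algebra_simps)
      then show ?thesis using z by (simp add: norm_mult)
    qed
    have ac: "cmod (z - ?c) = cmod (1 - w ^ n)"
    proof -
      have "z - ?c = ?c * (w ^ n - 1)" using wnz by (simp add: algebra_simps power_int_minus)
      then show ?thesis using c by (metis norm_mult mult_1 norm_minus_commute)
    qed
    have bc: "cmod (?b - ?c) = cmod (1 - w ^ (2 * n))"
    proof -
      have "w ^ n = inverse (w ^ n) * w ^ (n * 2)"
        using wnz by (simp add: mult_2_right power_add)
      then have "?b - ?c = ?c * (w ^ (2 * n) - 1)"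
        by (simp add: algebra_simps power_int_minus)
      then show ?thesis using c by (metis norm_mult mult_1 norm_minus_commute)
    qed
    have tri: "2 * ?r \<le> cmod (1 - x) \<or> 2 * ?r \<le> cmod (1 - y)" if "4 * ?r \<le> cmod (x - y)" for x y
    proof -
      have "cmod (x - y) \<le> cmod (1 - x) + cmod (1 - y)"
        using norm_triangle_ineq4[of "1 - y" "1 - x"] by simp
      then show ?thesis using that by linarith
    qed
    have "2 * ?r \<le> cmod (1 - z) \<or> 2 * ?r \<le> cmod (1 - ?b)" using tri d1 ab by simp
    moreover have "2 * ?r \<le> cmod (1 - z) \<or> 2 * ?r \<le> cmod (1 - ?c)" using tri d1 ac by simp
    moreover have "2 * ?r \<le> cmod (1 - ?b) \<or> 2 * ?r \<le> cmod (1 - ?c)" using tri d2 bc by simp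
    ultimately have "h z + h ?b + h ?c \<le> 7/5"
      using h1[OF z] h1[OF b] h1[OF c] h5[OF z] h5[OF b] h5[OF c] by linarith
    moreover have "0 \<le> 12 * (real n)\<^sup>2 * Y" using Y0 by simp
    ultimately show ?thesis by linarith
  next
    \<comment> \<open>Now \<open>w\<close> is far from 1, and the trivial bound 3 is absorbed by the
      term in \<open>Y\<close>.\<close>
    case False
    then have "1 ^ 2 \<le> (real (2 * n) * ?r) ^ 2" by (intro power_mono) auto
    then have "1 \<le> 4 * (real n)\<^sup>2 * Y" by (simp add: Y_def power_mult_distrib)
    then show ?thesis using h1[OF z] h1[OF b] h1[OF c] by linarith
  qed
qed

section \<open>Fejer kernels and the mass near the origin\<close>

lemma trig_list_of_sum:
  assumes "finite I"
  shows "\<exists>xs. (\<forall>z w. trig_eval xs z w = (\<Sum>i\<in>I. c i * (z powi fst (v i) * w powi snd (v i)))) \<and>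
    (\<forall>\<psi>. trig_apply \<psi> xs = (\<Sum>i\<in>I. c i * \<psi> (v i)))"
  using assms
proof (induction I)
  case empty
  show ?case by (rule exI[of _ "[]"]) (simp add: trig_eval_def trig_apply_def)
next
  case (insert i I)
  then obtain xs where "\<forall>z w. trig_eval xs z w = (\<Sum>i\<in>I. c i * (z powi fst (v i) * w powi snd (v i)))"
    "\<forall>\<psi>. trig_apply \<psi> xs = (\<Sum>i\<in>I. c i * \<psi> (v i))" by blast
  moreover have "trig_eval ((c i, v i) # xs) z w = c i * (z powi fst (v i) * w powi snd (v i)) + trig_eval xs z w" for z w
    by (simp add: trig_eval_def case_prod_unfold)
  moreover have "trig_apply \<psi> ((c i, v i) # xs) = c i * \<psi> (v i) + trig_apply \<psi> xs" for \<psi>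
    by (simp add: trig_apply_def)
  ultimately show ?case
    using insert by (intro exI[of _ "(c i, v i) # xs"]) simp
qed

text \<open>The Fejer kernel at \<open>z ^ R\<close>, normalised to have value 1 at
  \<open>z = 1\<close> when \<open>N > 0\<close>, instead of mean 1. Its nonzero frequencies are
  multiples of \<open>R\<close>, so a large \<open>R\<close> puts them where a function in
  \<open>c\<^sub>0\<close> is small.\<close>

definition fejer_kernel :: "nat \<Rightarrow> nat \<Rightarrow> complex \<Rightarrow> real" where
  "fejer_kernel N R z = (cmod (\<Sum>i<N. (z ^ R) ^ i) / real N)\<^sup>2"

lemma fejer_kernel_represented:
  "\<exists>xs. represents xs (\<lambda>z w. fejer_kernel N R z) \<and>
    (\<forall>\<psi>. trig_apply \<psi> xs = (\<Sum>i<N. \<Sum>j<N. \<psi> ((int i - int j) * int R, 0)) / of_nat N ^ 2)"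
proof -
  obtain xs where xs: "\<forall>z w. trig_eval xs z w = (\<Sum>x\<in>{..<N}\<times>{..<N}. 1 / of_nat N ^ 2 *
      (z powi fst ((int (fst x) - int (snd x)) * int R, 0::int) * w powi snd ((int (fst x) - int (snd x)) * int R, 0)))"
    "\<forall>\<psi>. trig_apply \<psi> xs = (\<Sum>x\<in>{..<N}\<times>{..<N}. 1 / of_nat N ^ 2 * \<psi> ((int (fst x) - int (snd x)) * int R, 0))"
    using trig_list_of_sum[of "{..<N}\<times>{..<N}"
       "\<lambda>x. 1 / of_nat N ^ 2" "\<lambda>x. ((int (fst x) - int (snd x)) * int R, 0)"] by auto
  have "represents xs (\<lambda>z w. fejer_kernel N R z)"
    unfolding represents_def
  proof (intro allI impI)
    fix z w :: complex assume z: "cmod z = 1" "cmod w = 1"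
    then have z0: "z \<noteq> 0" by auto
    have p: "z powi ((int i - int j) * int R) = (z ^ R) ^ i * cnj ((z ^ R) ^ j)" for i j
    proof -
      have "cnj ((z ^ R) ^ j) = inverse ((z ^ R) ^ j)"
        by (rule cnj_eq_inverse) (simp add: norm_power z)
      moreover have "z powi ((int i - int j) * int R) = (z ^ R) powi (int i - int j)"
        by (simp add: power_int_mult mult.commute)
      ultimately show ?thesis using z0 by (simp add: power_int_diff divide_inverse)
    qed
    have "of_real (fejer_kernel N R z) = (\<Sum>i<N. (z ^ R) ^ i) * cnj (\<Sum>i<N. (z ^ R) ^ i) / of_nat N ^ 2"
      unfolding fejer_kernel_def power_divide of_real_divide complex_norm_square by simp
    also have "\<dots> = (\<Sum>i<N. \<Sum>j<N. (z ^ R) ^ i * cnj ((z ^ R) ^ j)) / of_nat N ^ 2"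
      by (simp add: sum_product cnj_sum)
    also have "\<dots> = trig_eval xs z w"
      by (simp add: xs p sum.cartesian_product' sum_distrib_left sum_divide_distrib)
    finally show "trig_eval xs z w = of_real (fejer_kernel N R z)" by simp
  qed
  moreover have "trig_apply \<psi> xs = (\<Sum>i<N. \<Sum>j<N. \<psi> ((int i - int j) * int R, 0)) / of_nat N ^ 2" for \<psi>
    by (simp add: xs sum.cartesian_product' sum_divide_distrib)
  ultimately show ?thesis by blast
qed

text \<open>Each power of \<open>z ^ R\<close> in the kernel is within \<open>r\<close> of 1, so
  \<open>S\<close> is at least \<open>1 - r\<close> and \<open>1 - S\<^sup>2\<close> is at most
  \<open>2 * r\<close>.\<close>

lemma one_minus_fejer_kernel_le:
  assumes z: "cmod z = 1" and "N > 0" "\<epsilon> > 0"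
  shows "1 - fejer_kernel N R z \<le> \<epsilon> + (real N * real R)\<^sup>2 / \<epsilon> * (cmod (1 - z))\<^sup>2"
proof -
  define S where "S = cmod (\<Sum>i<N. (z ^ R) ^ i) / real N"
  define r where "r = real N * real R * cmod (1 - z)"
  have u: "cmod (z ^ R) = 1" by (simp add: z norm_power)
  have "cmod (of_nat N - (\<Sum>i<N. (z ^ R) ^ i)) = cmod (\<Sum>i<N. 1 - (z ^ R) ^ i)"
    by (simp add: sum_subtractf)
  also have "\<dots> \<le> (\<Sum>i<N. r)"
  proof (intro sum_norm_le)
    fix i assume "i \<in> {..<N}"
    have "cmod (1 - (z ^ R) ^ i) \<le> real i * (real R * cmod (1 - z))"
      using norm_one_minus_power_le[OF u, of i] norm_one_minus_power_le[OF z, of R]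
      by (meson mult_left_mono of_nat_0_le_iff order_trans)
    also have "\<dots> \<le> real N * (real R * cmod (1 - z))"
      using \<open>i \<in> {..<N}\<close> by (intro mult_right_mono) auto
    finally show "cmod (1 - (z ^ R) ^ i) \<le> r" by (simp add: r_def)
  qed
  finally have "cmod (of_nat N - (\<Sum>i<N. (z ^ R) ^ i)) \<le> real N * r" by simp
  moreover have "cmod (of_nat N :: complex) \<le> cmod (of_nat N - (\<Sum>i<N. (z ^ R) ^ i)) + cmod (\<Sum>i<N. (z ^ R) ^ i)"
    by (metis norm_triangle_sub add.commute)
  ultimately have "real N \<le> real N * r + real N * S" using \<open>N > 0\<close> by (simp add: S_def)
  then have "real N * 1 \<le> real N * (r + S)" by (simp add: algebra_simps)
  then have rS: "1 \<le> r + S" using \<open>N > 0\<close> by (simp only: mult_le_cancel_left_pos of_nat_0_less_iff)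
  have r0: "0 \<le> r" by (simp add: r_def)
  have "1 - S\<^sup>2 \<le> 2 * r"
  proof (cases "r \<le> 1")
    case True
    then have "(1 - r)\<^sup>2 \<le> S\<^sup>2" using rS by (intro power_mono) auto
    then show ?thesis unfolding power2_diff one_power2 using zero_le_power2[of r] by linarith
  next
    case False
    then show ?thesis using zero_le_power2[of S] by linarith
  qed
  \<comment> \<open>The arithmetic-geometric mean inequality replaces the linear \<open>r\<close> by
    its square, because \<open>(cmod (1 - z))\<^sup>2\<close> is a trigonometric polynomial and
    \<open>cmod (1 - z)\<close> is not.\<close>
  also have "2 * r \<le> \<epsilon> + r\<^sup>2 / \<epsilon>"
  proof -
    have "0 \<le> (\<epsilon> - r)\<^sup>2 / \<epsilon>" using \<open>\<epsilon> > 0\<close> by simp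
    also have "\<dots> = \<epsilon> + r\<^sup>2 / \<epsilon> - 2 * r" using \<open>\<epsilon> > 0\<close> by (simp add: power2_diff field_simps power2_eq_square)
    finally show ?thesis by simp
  qed
  finally show ?thesis by (simp add: fejer_kernel_def S_def[symmetric] r_def power_mult_distrib)
qed

text \<open>\<open>K\<close> will be a Fejer kernel: its \<open>\<psi>\<close>-integral is small when \<open>\<psi>\<close> is in \<open>c\<^sub>0\<close>, and it absorbs the defect
  \<open>1 - t * geom_poly m t\<close> near the origin.\<close>

lemma geom_poly_covers:
  fixes B :: real
  assumes "B \<ge> 0" "\<epsilon> > 0"
  obtains m where "\<And>t K. 0 \<le> t \<Longrightarrow> t \<le> 8 \<Longrightarrow> 0 \<le> K \<Longrightarrow> 1 - K \<le> \<epsilon> + B * t \<Longrightarrow>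
     1 \<le> t * geom_poly m t + K + 2 * \<epsilon>"
proof -
  obtain m where m: "8 * B / \<epsilon> < real m" using reals_Archimedean2 by blast
  have "1 \<le> t * geom_poly m t + K + 2 * \<epsilon>"
    if t: "0 \<le> t" "t \<le> 8" and K: "0 \<le> K" "1 - K \<le> \<epsilon> + B * t" for t K
  proof -
    define D where "D = (1 - t / 8) ^ Suc m"
    have D: "0 \<le> D" "D \<le> 1" using t by (auto simp: D_def intro!: zero_le_power power_le_one simp del: power_Suc)
    have "t / 8 * D \<le> 1 / real (Suc m)"
      unfolding D_def by (rule mult_power_one_minus_le) (use t in auto)
    then have "B * (8 * (t / 8 * D)) \<le> B * (8 * (1 / real (Suc m)))"
      using assms(1) by (intro mult_left_mono) auto
    also have "\<dots> \<le> \<epsilon>" using m assms by (simp add: field_simps)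
    finally have 1: "B * t * D \<le> \<epsilon>" by simp
    \<comment> \<open>The defect is split as \<open>D = K * D + (1 - K) * D\<close>. The first
      summand is at most \<open>K\<close>; in the second, the factor \<open>t\<close> of the bound
      on \<open>1 - K\<close> is compensated by the smallness of \<open>t * D\<close>.\<close>
    have "(1 - K) * D \<le> (\<epsilon> + B * t) * D" using K D by (intro mult_right_mono) auto
    also have "\<dots> = \<epsilon> * D + B * t * D" by (simp add: algebra_simps)
    also have "\<dots> \<le> \<epsilon> * 1 + \<epsilon>" using 1 D assms by (intro add_mono mult_left_mono) auto
    finally have "(1 - K) * D \<le> 2 * \<epsilon>" by simp
    moreover have "K * D \<le> K * 1" using K D by (intro mult_left_mono) auto
    moreover have "t * geom_poly m t = 1 - D" by (simp only: mult_geom_poly D_def)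
    ultimately show ?thesis by (simp add: algebra_simps)
  qed
  then show ?thesis using that by blast
qed

text \<open>For each \<open>i\<close> the diagonal term contributes at most 2. The other terms have
  frequency at least \<open>R\<close> in absolute value and contribute at most 1 together. Thus the
  total is at most 3000 out of \<open>1000 ^ 2\<close>.\<close>

lemma fejer_kernel_average_small:
  assumes R: "R > 0" "\<And>k. int R \<le> \<bar>k\<bar> \<Longrightarrow> cmod (\<psi> (k, 0)) \<le> 1 / 1000"
    and 0: "cmod (\<psi> (0, 0)) \<le> 2"
  shows "Re ((\<Sum>i<1000. \<Sum>j<1000. \<psi> ((int i - int j) * int R, 0)) / of_nat 1000 ^ 2) \<le> 3 / 1000"
proof -
  have 1: "cmod (\<psi> ((int i - int j) * int R, 0)) \<le> (if j = i then 2 else 0) + 1 / 1000" for i j :: nat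
  proof (cases "i = j")
    case False
    then have "1 * int R \<le> \<bar>int i - int j\<bar> * int R" by (intro mult_right_mono) auto
    then have "int R \<le> \<bar>(int i - int j) * int R\<bar>" by (simp add: abs_mult)
    then show ?thesis using R(2) False by simp
  qed (use 0 in simp)
  have "cmod (\<Sum>i<1000. \<Sum>j<1000. \<psi> ((int i - int j) * int R, 0)) \<le> (\<Sum>i<1000::nat. \<Sum>j<1000::nat. (if j = i then 2 else 0) + 1 / 1000)"
    by (intro sum_norm_le 1)
  also have "\<dots> = (\<Sum>i<1000::nat. 3)"
  proof (intro sum.cong refl)
    fix i :: nat assume "i \<in> {..<1000}"
    then show "(\<Sum>j<1000::nat. (if j = i then 2 else 0) + 1 / 1000) = (3::real)"
      by (simp only: sum.distrib sum.delta' finite_lessThan) simp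
  qed
  also have "\<dots> = 3000" by simp
  finally have "cmod ((\<Sum>i<1000. \<Sum>j<1000. \<psi> ((int i - int j) * int R, 0)) / of_nat 1000 ^ 2) \<le> 3 / 1000"
    by (simp add: norm_divide)
  then show ?thesis by (meson complex_Re_le_cmod order_trans)
qed

section \<open>Contradiction between decay and almost invariance\<close>

lemma three_translates_apply:
  assumes pd: "pos_def_Z2 \<psi>"
    and reps: "represents xs F" "represents xs1 F1" "represents xs2 F2" "represents ys G"
    and F: "\<And>z w. cmod z = 1 \<Longrightarrow> cmod w = 1 \<Longrightarrow> 0 \<le> F z w"
    and le: "\<And>z w. cmod z = 1 \<Longrightarrow> cmod w = 1 \<Longrightarrow> F z w + F1 z w + F2 z w \<le> 7/5 + C * G z w"
    and 1: "Re (trig_apply \<psi> xs) \<le> 21/20 * Re (trig_apply \<psi> xs1) + e"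
    and 2: "Re (trig_apply \<psi> xs) \<le> 21/20 * Re (trig_apply \<psi> xs2) + e"
  shows "3 * Re (trig_apply \<psi> xs) \<le> 21/20 * (7/5 * Re (\<psi> 0) + C * Re (trig_apply \<psi> ys)) + 2 * e"
proof -
  have a: "represents (xs @ xs1 @ xs2) (\<lambda>z w. F z w + (F1 z w + F2 z w))"
    by (intro represents_add reps)
  have b: "represents ([(of_real (7/5), 0, 0)] @ trig_scale (of_real C) ys) (\<lambda>z w. 7/5 + C * G z w)"
    by (intro represents_add represents_const represents_scale reps)
  have "Re (trig_apply \<psi> (xs @ xs1 @ xs2)) \<le> Re (trig_apply \<psi> ([(of_real (7/5), 0, 0)] @ trig_scale (of_real C) ys))"
    by (rule trig_apply_mono[OF pd a b]) (use le in \<open>simp add: add.assoc\<close>)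
  moreover have "trig_apply \<psi> [(of_real (7/5), 0, 0)] = of_real (7/5) * \<psi> 0"
    by (simp add: trig_apply_def zero_prod_def)
  then have "Re (trig_apply \<psi> [(of_real (7/5), 0, 0)]) = 7/5 * Re (\<psi> 0)"
    by (simp only: times_complex.sel Re_complex_of_real Im_complex_of_real mult_zero_left diff_zero)
  moreover have "Re (trig_apply \<psi> (trig_scale (of_real C) ys)) = C * Re (trig_apply \<psi> ys)"
    by (simp add: trig_apply_scale)
  ultimately have "Re (trig_apply \<psi> xs) + Re (trig_apply \<psi> xs1) + Re (trig_apply \<psi> xs2)
     \<le> 7/5 * Re (\<psi> 0) + C * Re (trig_apply \<psi> ys)"
    by (simp only: trig_apply_append plus_complex.sel)
  \<comment> \<open>Nonnegativity lets the untranslated term carry the factor 21/20 as well, so that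
    the inequality for the sum of the three translates can be multiplied by it.\<close>
  moreover have "0 \<le> Re (trig_apply \<psi> xs)" by (rule trig_apply_nonneg[OF pd reps(1) F])
  ultimately show ?thesis using 1 2 by argo
qed

text \<open>Decay along the first axis is enough because the Fejer kernel depends on
  \<open>z\<close> alone. The condition on \<open>\<kappa> 0\<close> says that the shears almost fix
  the cyclic vector, and \<open>\<eta>\<close> is of order \<open>1 / n ^ 2\<close> to beat the
  factor \<open>n ^ 2\<close> of \<open>three_translates\<close>.\<close>

theorem shear_invariant_pos_def_not_c0:
  fixes \<psi> :: "int \<times> int \<Rightarrow> complex" and n :: nat
  assumes n: "8 \<le> n" and pd: "pos_def_Z2 \<psi>"
    and c0: "\<And>\<epsilon>. \<epsilon> > 0 \<Longrightarrow> \<exists>R>0. \<forall>k. int R \<le> \<bar>k\<bar> \<longrightarrow> cmod (\<psi> (k, 0)) \<le> \<epsilon>"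
    and \<eta>: "\<eta> = 1 / (100000 * (real n)\<^sup>2)"
    and close: "\<And>v. v \<in> {(0, 0), (1, 0), (-1, 0), (0, 1), (0, -1)} \<Longrightarrow> cmod (\<psi> v - 1) \<le> \<eta>"
    and shear1: "\<And>k. k \<in> {int n, - int n} \<Longrightarrow> \<exists>\<kappa>. cmod (\<kappa> 0 - 2) \<le> 2 * \<eta> \<and>
      (\<forall>\<alpha> \<beta> :: real. pos_def_Z2 (\<lambda>v. of_real (\<alpha>\<^sup>2) * (case v of (p, q) \<Rightarrow> \<psi> (p, q + k * p))
         + of_real (\<beta>\<^sup>2) * \<psi> v + of_real (\<alpha> * \<beta>) * \<kappa> v))"
    and shear2: "\<And>k. k \<in> {int n, - int n} \<Longrightarrow> \<exists>\<kappa>. cmod (\<kappa> 0 - 2) \<le> 2 * \<eta> \<and>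
      (\<forall>\<alpha> \<beta> :: real. pos_def_Z2 (\<lambda>v. of_real (\<alpha>\<^sup>2) * (case v of (p, q) \<Rightarrow> \<psi> (p + k * q, q))
         + of_real (\<beta>\<^sup>2) * \<psi> v + of_real (\<alpha> * \<beta>) * \<kappa> v))"
  shows False
proof -
  have "(real n)\<^sup>2 \<ge> 8\<^sup>2" using n by (intro power_mono) auto
  then have n2\<eta>: "(real n)\<^sup>2 * \<eta> = 1 / 100000" and \<eta>0: "0 < \<eta>" and \<eta>1: "64 * \<eta> \<le> 1 / 100000"
    using n by (simp_all add: \<eta> divide_simps)
  have cl: "\<bar>Re (\<psi> v) - 1\<bar> \<le> \<eta>" if "v \<in> {(0, 0), (1, 0), (-1, 0), (0, 1), (0, -1)}" for v
    using close[OF that] abs_Re_le_cmod[of "\<psi> v - 1"] by simp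
  have \<psi>0: "\<bar>Re (\<psi> 0) - 1\<bar> \<le> \<eta>" using cl[of "(0, 0)"] by (simp add: zero_prod_def)
  obtain R where R: "R > 0" "\<And>k. int R \<le> \<bar>k\<bar> \<Longrightarrow> cmod (\<psi> (k, 0)) \<le> 1 / 1000"
    using c0[of "1/1000"] by auto
  obtain m where m: "\<And>t K. 0 \<le> t \<Longrightarrow> t \<le> 8 \<Longrightarrow> 0 \<le> K \<Longrightarrow> 1 - K \<le> 1/1000 + (real 1000 * real R)\<^sup>2 / (1/1000) * t \<Longrightarrow>
     1 \<le> t * geom_poly m t + K + 2 * (1/1000)"
    using geom_poly_covers[of "(real 1000 * real R)\<^sup>2 / (1/1000)" "1/1000"] by auto
  define X Y :: "complex \<Rightarrow> complex \<Rightarrow> real" where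
    "X = (\<lambda>z w. (cmod (1 - z))\<^sup>2)" and "Y = (\<lambda>z w. (cmod (1 - w))\<^sup>2)"
  define f where "f = (\<lambda>z w. X z w * geom_poly m (X z w + Y z w))"
  define h where "h = (\<lambda>z w. Y z w * geom_poly m (X z w + Y z w))"
  define xX xY :: "trig_list" where
    "xX = [(2, 0, 0), (-1, 1, 0), (-1, -1, 0)]" and "xY = [(2, 0, 0), (-1, 0, 1), (-1, 0, -1)]"
  have rX: "represents xX X" and rY: "represents xY Y"
    unfolding X_def Y_def xX_def xY_def by (rule represents_X represents_Y)+
  have LX: "Re (trig_apply \<psi> xX) \<le> 4 * \<eta>" and LY: "Re (trig_apply \<psi> xY) \<le> 4 * \<eta>"
    using cl[of "(0, 0)"] cl[of "(1, 0)"] cl[of "(-1, 0)"] cl[of "(0, 1)"] cl[of "(0, -1)"]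
    by (simp_all add: trig_apply_def xX_def xY_def)
  have tp: "trig_poly X" "trig_poly Y"
    using rX rY by (auto simp: trig_poly_def)
  have "trig_poly (\<lambda>z w. geom_poly m (X z w + Y z w))"
    unfolding geom_poly_def divide_inverse
    by (intro trig_poly_sum trig_poly_mult trig_poly_power trig_poly_diff trig_poly_add trig_poly_const tp)
  then have "trig_poly f" "trig_poly h"
    unfolding f_def h_def by (intro trig_poly_mult tp; assumption)+
  then obtain xf xh where xf: "represents xf f" and xh: "represents xh h"
    by (auto simp: trig_poly_def)
  have le4: "(cmod (1 - x))\<^sup>2 \<le> 4" if "cmod x = 1" for x :: complex
  proof -
    have "cmod (1 - x) \<le> 2" using norm_triangle_ineq4[of 1 x] that by simp
    then show ?thesis using power_mono[of "cmod (1 - x)" 2 2] by simp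
  qed
  have XY: "0 \<le> X z w" "0 \<le> Y z w" "X z w + Y z w \<le> 8" if "cmod z = 1" "cmod w = 1" for z w
    using le4 that by (simp_all add: X_def Y_def add_mono[of _ 4 _ 4, simplified])
  have fh: "0 \<le> f z w" "0 \<le> h z w" "f z w + h z w = (X z w + Y z w) * geom_poly m (X z w + Y z w)"
    "f z w + h z w \<le> 1"
    if "cmod z = 1" "cmod w = 1" for z w
    using XY[OF that] geom_poly_bounds[of "X z w + Y z w" m]
    by (auto simp: f_def h_def algebra_simps)
  \<comment> \<open>Both shears fix the origin, so \<open>\<psi>' 0 + \<psi> 0 - \<kappa> 0\<close>
    in \<open>almost_invariance\<close> has real part at most \<open>4 * \<eta>\<close>; the factor
    21 there gives 84.\<close>
  have inv1: "Re (trig_apply \<psi> xh) \<le> 21/20 * Re (trig_apply \<psi> (map (\<lambda>(c, p, q). (c, p, q + k * p)) xh)) + 84 * \<eta>"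
    if k: "k \<in> {int n, - int n}" for k
  proof -
    obtain \<kappa> where \<kappa>: "cmod (\<kappa> 0 - 2) \<le> 2 * \<eta>" "\<And>\<alpha> \<beta> :: real. pos_def_Z2 (\<lambda>v. of_real (\<alpha>\<^sup>2) * (case v of (p, q) \<Rightarrow> \<psi> (p, q + k * p))
         + of_real (\<beta>\<^sup>2) * \<psi> v + of_real (\<alpha> * \<beta>) * \<kappa> v)"
      using shear1[OF k] by blast
    have "\<bar>Re (\<kappa> 0) - 2\<bar> \<le> 2 * \<eta>" using \<kappa>(1) abs_Re_le_cmod[of "\<kappa> 0 - 2"] by simp
    moreover have "Re (trig_apply \<psi> xh) \<le> 21/20 * Re (trig_apply (\<lambda>(p, q). \<psi> (p, q + k * p)) xh)
        + 21 * Re ((case 0 of (p, q) \<Rightarrow> \<psi> (p, q + k * p)) + \<psi> 0 - \<kappa> 0)"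
      by (rule almost_invariance[OF \<kappa>(2) xh]) (use fh in smt)
    ultimately show ?thesis
      using \<psi>0 unfolding trig_apply_shear1 by (simp add: zero_prod_def)
  qed
  have inv2: "Re (trig_apply \<psi> xf) \<le> 21/20 * Re (trig_apply \<psi> (map (\<lambda>(c, p, q). (c, p + k * q, q)) xf)) + 84 * \<eta>"
    if k: "k \<in> {int n, - int n}" for k
  proof -
    obtain \<kappa> where \<kappa>: "cmod (\<kappa> 0 - 2) \<le> 2 * \<eta>" "\<And>\<alpha> \<beta> :: real. pos_def_Z2 (\<lambda>v. of_real (\<alpha>\<^sup>2) * (case v of (p, q) \<Rightarrow> \<psi> (p + k * q, q))
         + of_real (\<beta>\<^sup>2) * \<psi> v + of_real (\<alpha> * \<beta>) * \<kappa> v)"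
      using shear2[OF k] by blast
    have "\<bar>Re (\<kappa> 0) - 2\<bar> \<le> 2 * \<eta>" using \<kappa>(1) abs_Re_le_cmod[of "\<kappa> 0 - 2"] by simp
    moreover have "Re (trig_apply \<psi> xf) \<le> 21/20 * Re (trig_apply (\<lambda>(p, q). \<psi> (p + k * q, q)) xf)
        + 21 * Re ((case 0 of (p, q) \<Rightarrow> \<psi> (p + k * q, q)) + \<psi> 0 - \<kappa> 0)"
      by (rule almost_invariance[OF \<kappa>(2) xf]) (use fh in smt)
    ultimately show ?thesis
      using \<psi>0 unfolding trig_apply_shear2 by (simp add: zero_prod_def)
  qed
  have gb: "0 \<le> geom_poly m t \<and> t * geom_poly m t \<le> 1" if "0 \<le> t" "t \<le> 8" for t
    using geom_poly_bounds that by blast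
  have H: "3 * Re (trig_apply \<psi> xh) \<le> 21/20 * (7/5 * Re (\<psi> 0) + (12 * (real n)\<^sup>2) * Re (trig_apply \<psi> xY)) + 2 * (84 * \<eta>)"
  proof (rule three_translates_apply[OF pd xh represents_shear1[OF xh] represents_shear1[OF xh] rY])
    fix z w :: complex assume "cmod z = 1" "cmod w = 1"
    then show "h z w + h (z * w powi int n) w + h (z * w powi - int n) w \<le> 7/5 + 12 * (real n)\<^sup>2 * Y z w"
      unfolding h_def X_def Y_def using n gb by (intro three_translates)
  qed (rule inv1 fh(2); simp)+
  have F: "3 * Re (trig_apply \<psi> xf) \<le> 21/20 * (7/5 * Re (\<psi> 0) + (12 * (real n)\<^sup>2) * Re (trig_apply \<psi> xX)) + 2 * (84 * \<eta>)"
  proof (rule three_translates_apply[OF pd xf represents_shear2[OF xf] represents_shear2[OF xf] rX])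
    fix z w :: complex assume "cmod z = 1" "cmod w = 1"
    then show "f z w + f z (w * z powi int n) + f z (w * z powi - int n) \<le> 7/5 + 12 * (real n)\<^sup>2 * X z w"
      unfolding f_def X_def Y_def
      using n gb three_translates[of w z n "geom_poly m"] by (simp only: add.commute)
  qed (rule inv2 fh(1); simp)+
  obtain xK where xK: "represents xK (\<lambda>z w. fejer_kernel 1000 R z)"
    "\<And>\<psi>. trig_apply \<psi> xK = (\<Sum>i<1000. \<Sum>j<1000. \<psi> ((int i - int j) * int R, 0)) / of_nat 1000 ^ 2"
    using fejer_kernel_represented[of 1000 R] by blast
  have "cmod (\<psi> (0, 0)) \<le> 2"
  proof -
    have "cmod (\<psi> (0, 0)) \<le> cmod (\<psi> (0, 0) - 1) + cmod 1"
      by (metis norm_triangle_sub add.commute)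
    then show ?thesis using close[of "(0, 0)"] \<eta>1 \<eta>0 by simp
  qed
  then have K: "Re (trig_apply \<psi> xK) \<le> 3 / 1000"
    unfolding xK(2) by (intro fejer_kernel_average_small R)
  \<comment> \<open>998/1000 is 1 minus twice the tolerance 1/1000 used in the choice of
    \<open>m\<close>.\<close>
  have one: "represents [(of_real (998/1000), 0, 0)] (\<lambda>z w. 998/1000)"
    by (rule represents_const)
  have "Re (trig_apply \<psi> [(of_real (998/1000), 0, 0)]) \<le> Re (trig_apply \<psi> ((xf @ xh) @ xK))"
  proof (rule trig_apply_mono[OF pd one represents_add[OF represents_add[OF xf xh] xK(1)]])
    fix z w :: complex assume zw: "cmod z = 1" "cmod w = 1"
    have "1 - fejer_kernel 1000 R z \<le> 1/1000 + (real 1000 * real R)\<^sup>2 / (1/1000) * X z w"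
      unfolding X_def by (rule one_minus_fejer_kernel_le) (use zw in auto)
    also have "\<dots> \<le> 1/1000 + (real 1000 * real R)\<^sup>2 / (1/1000) * (X z w + Y z w)"
      using XY[OF zw] by (intro add_left_mono mult_left_mono) auto
    finally have "1 \<le> (X z w + Y z w) * geom_poly m (X z w + Y z w) + fejer_kernel 1000 R z + 2 * (1/1000)"
      using XY[OF zw] by (intro m) (auto simp: fejer_kernel_def)
    then show "998/1000 \<le> f z w + h z w + fejer_kernel 1000 R z"
      unfolding fh(3)[OF zw] by linarith
  qed
  moreover have "trig_apply \<psi> [(of_real (998/1000), 0, 0)] = of_real (998/1000) * \<psi> 0"
    by (simp add: trig_apply_def zero_prod_def)
  then have "Re (trig_apply \<psi> [(of_real (998/1000), 0, 0)]) = 998/1000 * Re (\<psi> 0)"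
    by (simp only: times_complex.sel Re_complex_of_real Im_complex_of_real mult_zero_left diff_zero)
  ultimately have sum: "998/1000 * Re (\<psi> 0) \<le> Re (trig_apply \<psi> xf) + Re (trig_apply \<psi> xh) + Re (trig_apply \<psi> xK)"
    by (simp only: trig_apply_append plus_complex.sel)
  have "12 * (real n)\<^sup>2 * Re (trig_apply \<psi> xX) \<le> 12 * (real n)\<^sup>2 * (4 * \<eta>)"
    using LX by (intro mult_left_mono) auto
  then have X: "12 * (real n)\<^sup>2 * Re (trig_apply \<psi> xX) \<le> 48 / 100000" using n2\<eta> by simp
  have "12 * (real n)\<^sup>2 * Re (trig_apply \<psi> xY) \<le> 12 * (real n)\<^sup>2 * (4 * \<eta>)"
    using LY by (intro mult_left_mono) auto
  then have Y: "12 * (real n)\<^sup>2 * Re (trig_apply \<psi> xY) \<le> 48 / 100000" using n2\<eta> by simp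
  \<comment> \<open>Up to errors of order \<open>\<eta>\<close> and the terms bounded by
    \<open>X\<close> and \<open>Y\<close>, three times the sum of the two integrals is at least
    \<open>3 * (998 - 3) / 1000 = 2.985\<close>, but at most
    \<open>21/20 * 14/5 = 2.94\<close>.\<close>
  show False using sum H F K X Y \<psi>0 \<eta>1 \<eta>0 by argo
qed

section \<open>Transvections in normal subgroups\<close>

definition dot3 :: "'a::comm_ring_1 ^ 3 \<Rightarrow> 'a ^ 3 \<Rightarrow> 'a" where
  "dot3 u v = u$1 * v$1 + u$2 * v$2 + u$3 * v$3"

definition outer :: "'a::comm_ring_1 ^ 3 \<Rightarrow> 'a ^ 3 \<Rightarrow> 'a ^ 3 ^ 3" where
  "outer u v = (\<chi> i j. u$i * v$j)"

text \<open>The map sending \<open>x\<close> to \<open>x + dot3 v x *s u\<close>, with column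
  \<open>u\<close> and row \<open>v\<close>. By \<open>det_transvection\<close> it lies in
  \<open>SL\<close> exactly when \<open>dot3 v u = 0\<close>.\<close>

definition transvection :: "'a::comm_ring_1 ^ 3 \<Rightarrow> 'a ^ 3 \<Rightarrow> 'a ^ 3 ^ 3" where
  "transvection u v = mat 1 + outer u v"

lemma matrix_mult_outer: "A ** outer u v = outer (A *v u) v"
  by (simp add: vec_eq_iff matrix_matrix_mult_def matrix_vector_mult_def outer_def sum_distrib_right mult.assoc)

lemma outer_mult_matrix: "outer u v ** B = outer u (v v* B)"
  by (simp add: vec_eq_iff matrix_matrix_mult_def vector_matrix_mult_def outer_def sum_distrib_left mult_ac)

lemma outer_vector: "outer u v *v x = dot3 v x *s u"
  by (simp add: vec_eq_iff matrix_vector_mult_def outer_def sum_3 dot3_def algebra_simps)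

lemma dot3_simps:
  "dot3 (u + u') v = dot3 u v + dot3 u' v" "dot3 u (v + v') = dot3 u v + dot3 u v'"
  "dot3 (a *s u) v = a * dot3 u v" "dot3 u (a *s v) = a * dot3 u v"
  "dot3 (- u) v = - dot3 u v" "dot3 u (- v) = - dot3 u v"
  "dot3 (u - u') v = dot3 u v - dot3 u' v" "dot3 u (v - v') = dot3 u v - dot3 u v'"
  by (simp_all add: dot3_def algebra_simps)

lemma dot3_matrix: "dot3 (v v* A) u = dot3 v (A *v u)"
  by (simp add: dot3_def vector_matrix_mult_def matrix_vector_mult_def sum_3 algebra_simps)

lemma outer_simps:
  "outer (u + u') v = outer u v + outer u' v" "outer u (v + v') = outer u v + outer u v'"
  "outer (- u) v = - outer u v" "outer u (- v) = - outer u v"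
  "outer (u - u') v = outer u v - outer u' v" "outer u (v - v') = outer u v - outer u v'"
  "outer (a *s u) (b *s v) = outer ((a * b) *s u) v"
  by (simp_all add: vec_eq_iff outer_def algebra_simps)

lemma transvection_vector: "transvection u v *v x = x + dot3 v x *s u"
  by (simp add: transvection_def matrix_vector_mult_add_rdistrib outer_vector)

lemma vector_transvection: "x v* transvection u v = x + dot3 x u *s v"
  by (simp add: transvection_def vec_eq_iff vector_matrix_mult_def outer_def sum_3 dot3_def forall_3 mat_def algebra_simps)

lemma matrix_mult_add_left:
  fixes A :: "'a::comm_ring_1 ^ 'n ^ 'm"
  shows "(A + B) ** C = A ** C + B ** C"
  by (simp add: vec_eq_iff matrix_matrix_mult_def sum.distrib distrib_right)

lemma transvection_mult_same_row:
  "dot3 v u' = 0 \<Longrightarrow> transvection u v ** transvection u' v = transvection (u + u') v"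
  by (simp add: transvection_def[of u' v] matrix_add_ldistrib matrix_mult_outer transvection_vector)
    (simp add: transvection_def outer_simps)

lemma transvection_mult_same_col:
  "dot3 v u = 0 \<Longrightarrow> transvection u v ** transvection u v' = transvection u (v + v')"
  by (simp add: transvection_def[of u v'] matrix_add_ldistrib matrix_mult_outer transvection_vector)
    (simp add: transvection_def outer_simps)

lemma transvection_zero: "transvection 0 v = mat 1"
  by (simp add: transvection_def outer_def vec_eq_iff)

lemma transvection_scale: "transvection (a *s u) (b *s v) = transvection ((a * b) *s u) v"
  by (simp add: transvection_def outer_simps)

lemma transvection_inverse:
  assumes "dot3 v u = 0"
  shows "transvection u v ** transvection (- u) v = mat 1"
    "transvection (- u) v ** transvection u v = mat 1"
  using assms by (simp_all add: transvection_mult_same_row transvection_zero dot3_simps)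

lemma det_transvection: "det (transvection u v) = 1 + dot3 v u"
  by (simp add: det_3 transvection_def outer_def mat_def dot3_def algebra_simps)

lemma conj_transvection:
  assumes "A ** B = mat 1"
  shows "A ** transvection u v ** B = transvection (A *v u) (v v* B)"
  using assms
  by (simp add: transvection_def matrix_add_ldistrib matrix_mult_add_left matrix_mult_outer outer_mult_matrix)

lemma in_SL: "A \<in> carrier SL \<longleftrightarrow> det A = 1"
  by (simp add: SL_def)

lemma SL_mult: "x \<otimes>\<^bsub>SL\<^esub> y = x ** y" and SL_one: "\<one>\<^bsub>SL\<^esub> = mat 1"
  by (simp_all add: SL_def)

lemma SL_inv:
  fixes A :: "'a::comm_ring_1 ^ 3 ^ 3"
  assumes "A \<in> carrier SL"
  shows "A ** inv\<^bsub>SL\<^esub> A = mat 1" "inv\<^bsub>SL\<^esub> A ** A = mat 1"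
proof -
  interpret group "SL :: ('a ^ 3 ^ 3) monoid" by (rule SL3_group)
  show "A ** inv\<^bsub>SL\<^esub> A = mat 1" "inv\<^bsub>SL\<^esub> A ** A = mat 1"
    using r_inv[OF assms] l_inv[OF assms] by (simp_all add: SL_mult SL_one)
qed

lemma SL_inv_eq:
  fixes A :: "'a::comm_ring_1 ^ 3 ^ 3"
  assumes "B ** A = mat 1" "A \<in> carrier SL" "B \<in> carrier SL"
  shows "inv\<^bsub>SL\<^esub> A = B"
proof -
  interpret group "SL :: ('a ^ 3 ^ 3) monoid" by (rule SL3_group)
  show ?thesis using assms by (intro inv_equality) (simp_all add: SL_mult SL_one)
qed

lemma transvection_in_SL: "dot3 v u = 0 \<Longrightarrow> transvection u v \<in> carrier SL"
  by (simp add: in_SL det_transvection)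

lemma inv_transvection: "dot3 v u = 0 \<Longrightarrow> inv\<^bsub>SL\<^esub> (transvection u v) = transvection (- u) v"
  by (rule SL_inv_eq) (simp_all add: transvection_inverse transvection_in_SL dot3_simps)

lemma normal_SL_closed:
  fixes H :: "('a::comm_ring_1 ^ 3 ^ 3) set"
  assumes "H \<lhd> SL"
  shows "x \<in> H \<Longrightarrow> y \<in> H \<Longrightarrow> x ** y \<in> H"
    and "x \<in> H \<Longrightarrow> x \<in> carrier SL"
    and "x \<in> H \<Longrightarrow> inv\<^bsub>SL\<^esub> x \<in> H"
    and "x \<in> H \<Longrightarrow> A \<in> carrier SL \<Longrightarrow> A ** x ** inv\<^bsub>SL\<^esub> A \<in> H"
proof -
  interpret normal H SL by fact
  show "x \<in> H \<Longrightarrow> y \<in> H \<Longrightarrow> x ** y \<in> H" using subgroup.m_closed[OF is_subgroup] by (simp add: SL_mult)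
  show "x \<in> H \<Longrightarrow> x \<in> carrier SL" using subset by blast
  show "x \<in> H \<Longrightarrow> inv\<^bsub>SL\<^esub> x \<in> H" by simp
  show "x \<in> H \<Longrightarrow> A \<in> carrier SL \<Longrightarrow> A ** x ** inv\<^bsub>SL\<^esub> A \<in> H"
    using inv_op_closed2 by (simp add: SL_mult)
qed

context
  fixes H :: "('a::comm_ring_1 ^ 3 ^ 3) set"
  assumes H: "H \<lhd> SL"
begin

lemma transvection_conj_mem:
  assumes "transvection r y \<in> H" "dot3 q p = 0"
  shows "transvection (r + dot3 q r *s p) (y - dot3 y p *s q) \<in> H"
proof -
  have "transvection p q ** transvection r y ** transvection (- p) q \<in> H"
    using normal_SL_closed(4)[OF H assms(1) transvection_in_SL[OF assms(2)]] assms(2)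
    by (simp add: inv_transvection)
  then show ?thesis
    using assms(2)
    by (simp add: conj_transvection transvection_inverse transvection_vector vector_transvection dot3_simps
        vector_smult_lneg)
qed

lemma transvection_minus_mem:
  assumes "transvection r y \<in> H" "dot3 y r = 0"
  shows "transvection (- r) y \<in> H"
  using normal_SL_closed(3)[OF H assms(1)] assms(2) by (simp add: inv_transvection)

text \<open>This is the commutator with \<open>transvection p q\<close>: since \<open>y\<close> is
  orthogonal to \<open>p\<close>, conjugation keeps the row and adds \<open>dot3 q r *s p\<close> to
  the column; multiplying by the inverse leaves the added part.\<close>

lemma change_column:
  assumes "transvection r y \<in> H" "dot3 y r = 0" "dot3 y p = 0" "dot3 q p = 0"
  shows "transvection (dot3 q r *s p) y \<in> H"
proof -
  have "transvection (r + dot3 q r *s p) y ** transvection (- r) y \<in> H"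
    using normal_SL_closed(1)[OF H transvection_conj_mem[OF assms(1,4)] transvection_minus_mem[OF assms(1,2)]] assms(3)
    by simp
  then show ?thesis using assms(2) by (simp add: transvection_mult_same_row dot3_simps)
qed

text \<open>Dual to \<open>change_column\<close>: the column is kept because
  \<open>dot3 q r = 0\<close>. Conjugating with \<open>- p\<close> in place of \<open>p\<close>
  gives the surviving row a positive sign.\<close>

lemma change_row:
  assumes "transvection r y \<in> H" "dot3 y r = 0" "dot3 q r = 0" "dot3 q p = 0"
  shows "transvection r (dot3 y p *s q) \<in> H"
proof -
  have "transvection (- r) y = transvection r (- y)"
    by (simp add: transvection_def outer_simps)
  then have "transvection r (- y) \<in> H"
    using transvection_minus_mem[OF assms(1,2)] by simp
  moreover have "transvection r (y - dot3 y (- p) *s q) \<in> H"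
    using transvection_conj_mem[OF assms(1), of q "- p"] assms(3,4) by (simp add: dot3_simps)
  ultimately have "transvection r (y - dot3 y (- p) *s q) ** transvection r (- y) \<in> H"
    by (rule normal_SL_closed(1)[OF H, rotated])
  then show ?thesis
    using assms by (simp add: transvection_mult_same_col dot3_simps vector_smult_lneg)
qed

text \<open>The commutator \<open>k\<close> of \<open>g\<close> and \<open>transvection p q\<close> fixes every row \<open>y\<close> orthogonal to \<open>p\<close> and \<open>g p\<close>, so the
  commutator of \<open>k\<close> and \<open>transvection p y\<close> is again a transvection.\<close>

lemma commutator_transvection:
  assumes g: "g \<in> H" and qp: "dot3 q p = 0" and yp: "dot3 y p = 0" and yg: "dot3 y (g *v p) = 0"
  shows "transvection (dot3 q (inv\<^bsub>SL\<^esub> g *v p) *s (g *v p)) y \<in> H"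
proof -
  let ?g' = "inv\<^bsub>SL\<^esub> g"
  have gS: "g \<in> carrier SL" using g by (rule normal_SL_closed(2)[OF H])
  have g': "?g' \<in> H" using g by (rule normal_SL_closed(3)[OF H])
  define k where "k = transvection (g *v p) (q v* ?g') ** transvection (- p) q"
  have "k = g ** (transvection p q ** ?g' ** transvection (- p) q)"
    using SL_inv[OF gS] by (simp add: k_def conj_transvection[symmetric] matrix_mul_assoc)
  moreover have "transvection p q ** ?g' ** transvection (- p) q \<in> H"
    using normal_SL_closed(4)[OF H g' transvection_in_SL[OF qp]] qp by (simp add: inv_transvection)
  ultimately have k: "k \<in> H" using normal_SL_closed(1)[OF H g] by simp
  then have kS: "k \<in> carrier SL" by (rule normal_SL_closed(2)[OF H])
  let ?k' = "inv\<^bsub>SL\<^esub> k"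
  have yk: "y v* k = y"
    unfolding k_def vector_matrix_mul_assoc[symmetric] vector_transvection using yp yg by (simp add: dot3_simps)
  have "y v* ?k' = (y v* k) v* ?k'" by (simp add: yk)
  also have "\<dots> = y" using SL_inv[OF kS] by (simp add: vector_matrix_mul_assoc)
  finally have yk': "y v* ?k' = y" .
  have kp: "k *v p = p + dot3 q (?g' *v p) *s (g *v p)"
    using qp unfolding k_def matrix_vector_mul_assoc[symmetric] transvection_vector
    by (simp add: dot3_simps dot3_matrix)
  have "transvection p y ** ?k' ** transvection (- p) y \<in> H"
    using normal_SL_closed(4)[OF H normal_SL_closed(3)[OF H k] transvection_in_SL[OF yp]] yp by (simp add: inv_transvection)
  then have "k ** (transvection p y ** ?k' ** transvection (- p) y) \<in> H"
    by (rule normal_SL_closed(1)[OF H k])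
  also have "k ** (transvection p y ** ?k' ** transvection (- p) y) = transvection (k *v p) y ** transvection (- p) y"
    using SL_inv[OF kS] conj_transvection[of k ?k' p y] yk' by (simp add: matrix_mul_assoc)
  also have "\<dots> = transvection (dot3 q (?g' *v p) *s (g *v p)) y"
    using yp by (simp add: transvection_mult_same_row dot3_simps kp)
  finally show ?thesis .
qed

end

section \<open>From a nontrivial element to elementary matrices\<close>

definition cross_prod :: "'a::comm_ring_1 ^ 3 \<Rightarrow> 'a ^ 3 \<Rightarrow> 'a ^ 3" where
  "cross_prod u v = vector [u$2 * v$3 - u$3 * v$2, u$3 * v$1 - u$1 * v$3, u$1 * v$2 - u$2 * v$1]"

lemma dot3_cross_prod: "dot3 (cross_prod u v) u = 0" "dot3 (cross_prod u v) v = 0"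
  by (simp_all add: dot3_def cross_prod_def algebra_simps)

lemma cross_prod_scale: "cross_prod u (a *s v) = a *s cross_prod u v"
  by (simp add: cross_prod_def vec_eq_iff forall_3 algebra_simps)

lemma cross_prod_self: "cross_prod u u = 0"
  by (simp add: cross_prod_def vec_eq_iff forall_3 mult.commute)

lemma matrix_vector_scale:
  fixes A :: "'a::comm_ring_1 ^ 'n ^ 'm"
  shows "A *v (c *s x) = c *s (A *v x)"
  by (simp add: vec_eq_iff matrix_vector_mult_def sum_distrib_left mult_ac)

text \<open>If \<open>g\<close> maps every vector to a parallel one, the unit vectors make it
  diagonal and their sums make the diagonal constant. The cube of the diagonal entry is then 1, so
  the integer entry is 1.\<close>

lemma nonparallel_vector_exists:
  fixes g :: "int ^ 3 ^ 3"
  assumes "det g = 1" "g \<noteq> mat 1"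
  shows "\<exists>p. cross_prod p (g *v p) \<noteq> 0"
proof (rule ccontr)
  assume "\<not> ?thesis"
  then have c: "cross_prod (vector [a, b, c]) (g *v vector [a, b, c]) = 0" for a b c by blast
  have off: "g$2$1 = 0" "g$3$1 = 0" "g$1$2 = 0" "g$3$2 = 0" "g$1$3 = 0" "g$2$3 = 0"
    using c[of 1 0 0] c[of 0 1 0] c[of 0 0 1]
    by (simp_all add: cross_prod_def vec_eq_iff forall_3 matrix_vector_mult_def sum_3)
  then have diag: "g$1$1 = g$2$2" "g$1$1 = g$3$3"
    using c[of 1 1 0] c[of 1 0 1]
    by (simp_all add: cross_prod_def vec_eq_iff forall_3 matrix_vector_mult_def sum_3)
  have "g$1$1 * (g$1$1 * g$1$1) = 1"
    using assms(1) off diag by (simp add: det_3)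
  then have "\<bar>g$1$1\<bar> = 1" by (metis dvd_triv_left zdvd1_eq)
  with \<open>g$1$1 * (g$1$1 * g$1$1) = 1\<close> have "g$1$1 = 1" by (auto simp: abs_if split: if_splits)
  then have "g = mat 1" using off diag by (simp add: vec_eq_iff forall_3 mat_def)
  then show False using assms(2) by contradiction
qed

definition e1 :: "int ^ 3" where "e1 = vector [1, 0, 0]"
definition e2 :: "int ^ 3" where "e2 = vector [0, 1, 0]"
definition e3 :: "int ^ 3" where "e3 = vector [0, 0, 1]"

context
  fixes H :: "(int ^ 3 ^ 3) set"
  assumes H: "H \<lhd> SL"
begin

text \<open>\<open>commutator_transvection\<close> is applied with \<open>y\<close> the cross
  product of \<open>p\<close> and \<open>g *v p\<close>, orthogonal to both, and \<open>q\<close> a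
  cross product with \<open>p\<close>. The scalar in front is a triple product, made nonzero by the
  choice of \<open>w\<close>.\<close>

lemma nontrivial_transvection_mem:
  assumes g: "g \<in> H" "g \<noteq> mat 1"
  shows "\<exists>r y. transvection r y \<in> H \<and> dot3 y r = 0 \<and> r \<noteq> 0 \<and> y \<noteq> 0"
proof -
  have gS: "g \<in> carrier SL" using g normal_SL_closed(2)[OF H] by blast
  then obtain p where p: "cross_prod p (g *v p) \<noteq> 0"
    using nonparallel_vector_exists g by (auto simp: in_SL)
  let ?s = "inv\<^bsub>SL\<^esub> g *v p"
  have gs: "g *v ?s = p" by (simp add: matrix_vector_mul_assoc SL_inv[OF gS])
  have gp: "g *v p \<noteq> 0" using p by (auto simp: cross_prod_def vec_eq_iff forall_3)
  \<comment> \<open>If \<open>p\<close> were parallel to its preimage \<open>?s\<close>, applying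
    \<open>g\<close> would make \<open>g *v p\<close> parallel to \<open>p\<close>.\<close>
  have "cross_prod p ?s \<noteq> 0"
  proof
    assume 0: "cross_prod p ?s = 0"
    have "p \<noteq> 0" using gp by auto
    then obtain i where i: "p$i \<noteq> 0" by (auto simp: vec_eq_iff)
    have "(p$i) *s ?s = (?s$i) *s p"
      using 0 exhaust_3[of i] by (auto simp: cross_prod_def vec_eq_iff forall_3 algebra_simps)
    then have "g *v ((p$i) *s ?s) = g *v ((?s$i) *s p)" by simp
    then have e: "(p$i) *s p = (?s$i) *s (g *v p)"
      by (simp only: matrix_vector_scale gs)
    have "(?s$i) *s cross_prod p (g *v p) = 0"
      unfolding cross_prod_scale[symmetric] e[symmetric] by (simp add: cross_prod_scale cross_prod_self)
    then have "?s$i = 0" using p by (simp add: vec_eq_iff) blast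
    then show False using e i by (auto simp: vec_eq_iff)
  qed
  then obtain w where w: "dot3 w (cross_prod p ?s) \<noteq> 0"
  proof -
    have "dot3 (vector [1, 0, 0]) (cross_prod p ?s) \<noteq> 0 \<or> dot3 (vector [0, 1, 0]) (cross_prod p ?s) \<noteq> 0
       \<or> dot3 (vector [0, 0, 1]) (cross_prod p ?s) \<noteq> 0"
      using \<open>cross_prod p ?s \<noteq> 0\<close> by (auto simp: dot3_def vec_eq_iff forall_3)
    then show ?thesis using that by blast
  qed
  define q where "q = cross_prod w p"
  have "dot3 q ?s = dot3 w (cross_prod p ?s)"
    by (simp add: q_def dot3_def cross_prod_def algebra_simps)
  then have q: "dot3 q ?s \<noteq> 0" using w by simp
  let ?y = "cross_prod p (g *v p)"
  have "transvection (dot3 q ?s *s (g *v p)) ?y \<in> H"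
    by (rule commutator_transvection[OF H g(1)]) (simp_all add: q_def dot3_cross_prod)
  moreover have "dot3 q ?s *s (g *v p) \<noteq> 0" using q gp by (auto simp: vec_eq_iff)
  ultimately show ?thesis using p by (metis dot3_cross_prod(2) dot3_simps(4) mult_zero_right)
qed

text \<open>Three moves: make the first entry of the row zero, so that \<open>e1\<close> is an
  admissible column; replace the column by a multiple of \<open>e1\<close>; replace the row by a
  multiple of \<open>e3\<close>. Nonzero scalars stay nonzero over the integers.\<close>

lemma e13_mem:
  assumes r: "transvection r y \<in> H" "dot3 y r = 0" "r \<noteq> 0" "y \<noteq> 0"
  shows "\<exists>n. n \<noteq> 0 \<and> transvection (n *s e1) e3 \<in> H"
proof -
  have "\<exists>y. transvection r y \<in> H \<and> dot3 y r = 0 \<and> y \<noteq> 0 \<and> y$1 = 0"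
  proof (cases "y$1 = 0")
    case False
    \<comment> \<open>Orthogonal to both \<open>r\<close> and \<open>e1\<close>. It is nonzero:
      otherwise \<open>r\<close> is a nonzero multiple of \<open>e1\<close>, and
      \<open>dot3 y r = 0\<close> would force \<open>y$1 = 0\<close>.\<close>
    define q :: "int ^ 3" where "q = vector [0, r$3, - (r$2)]"
    have q: "dot3 q r = 0" "dot3 q e1 = 0" by (simp_all add: dot3_def q_def e1_def)
    have "transvection r (dot3 y e1 *s q) \<in> H"
      by (rule change_row[OF H r(1,2) q])
    moreover have "q \<noteq> 0"
      using False r by (auto simp: q_def vec_eq_iff forall_3 dot3_def)
    ultimately show ?thesis
      using False q by (intro exI[of _ "dot3 y e1 *s q"]) (auto simp: dot3_simps q_def vec_eq_iff forall_3 dot3_def e1_def)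
  qed (use r in blast)
  then obtain y where y: "transvection r y \<in> H" "dot3 y r = 0" "y \<noteq> 0" "y$1 = 0" by blast
  have "\<exists>c. c \<noteq> 0 \<and> transvection (c *s e1) y \<in> H"
  proof (cases "r$2 = 0 \<and> r$3 = 0")
    case True
    then have "r = r$1 *s e1" by (simp add: e1_def vec_eq_iff forall_3)
    then show ?thesis using y r(3) by (metis vector_smult_lzero)
  next
    case False
    \<comment> \<open>Chosen so that \<open>dot3 q r\<close> is a nonzero sum of two
      squares.\<close>
    define q :: "int ^ 3" where "q = vector [0, r$2, r$3]"
    have "transvection (dot3 q r *s e1) y \<in> H"
      by (rule change_column[OF H y(1,2)]) (simp_all add: dot3_def q_def e1_def y)
    moreover have "dot3 q r \<noteq> 0"
      using False sum_squares_eq_zero_iff[of "r$2" "r$3"] by (auto simp: q_def dot3_def)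
    ultimately show ?thesis by blast
  qed
  then obtain c where c: "c \<noteq> 0" "transvection (c *s e1) y \<in> H" by blast
  show ?thesis
  proof (cases "y$2 = 0")
    case True
    then have ye: "y = y$3 *s e3" using y by (simp add: e3_def vec_eq_iff forall_3)
    have "transvection ((c * y$3) *s e1) e3 = transvection (c *s e1) y"
      by (subst ye) (simp add: transvection_scale)
    moreover have "y$3 \<noteq> 0" using ye y(3) by auto
    ultimately show ?thesis using c by (metis mult_eq_0_iff)
  next
    case False
    have "transvection (c *s e1) (dot3 y (y$2 *s e2) *s e3) \<in> H"
      by (rule change_row[OF H c(2)]) (simp_all add: dot3_def e1_def e2_def e3_def y)
    then have "transvection ((c * dot3 y (y$2 *s e2)) *s e1) e3 \<in> H"
      by (simp add: transvection_scale)
    moreover have "dot3 y (y$2 *s e2) \<noteq> 0" using False by (simp add: dot3_def e2_def)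
    ultimately show ?thesis using c by (metis mult_eq_0_iff)
  qed
qed

text \<open>Each commutator moves one index of the elementary matrix. The multiplier
  \<open>m\<close> sits in an auxiliary vector, so all multiples of \<open>n\<close> arise at once;
  those in position (1,3) are reached through (2,3) and back.\<close>

lemma elementary_mem:
  assumes "transvection (n *s e1) e3 \<in> H"
  shows "transvection ((n * m) *s e1) e3 \<in> H" "transvection ((n * m) *s e2) e3 \<in> H"
    "transvection ((n * m) *s e1) e2 \<in> H" "transvection ((n * m) *s e2) e1 \<in> H"
proof -
  have e23: "transvection ((n * m) *s e2) e3 \<in> H" for m
    using change_column[OF H assms, of e2 "m *s e1"]
    by (simp add: dot3_def e1_def e2_def e3_def mult.commute)
  show "transvection ((n * m) *s e2) e3 \<in> H" by (rule e23)
  show "transvection ((n * m) *s e1) e3 \<in> H"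
    using change_column[OF H e23[of 1], of e1 "m *s e2"]
    by (simp add: dot3_def e1_def e2_def e3_def mult.commute)
  show "transvection ((n * m) *s e1) e2 \<in> H"
    using change_row[OF H assms, of e2 "m *s e3"]
    by (simp add: dot3_def e1_def e2_def e3_def transvection_scale[of n _ m, symmetric])
  show "transvection ((n * m) *s e2) e1 \<in> H"
    using change_row[OF H e23[of 1], of e1 "m *s e3"]
    by (simp add: dot3_def e1_def e2_def e3_def transvection_scale[of n _ m, symmetric])
qed

end

section \<open>Positive definite functions and the shear action\<close>

lemma positive_definite_on_family:
  assumes pd: "positive_definite_on G \<phi>" and I: "finite I" "inj_on x I" "x ` I \<subseteq> carrier G"
  shows "(\<Sum>i\<in>I. \<Sum>j\<in>I. cnj (d i) * d j * \<phi> (inv\<^bsub>G\<^esub> (x i) \<otimes>\<^bsub>G\<^esub> x j)) \<in> \<real>\<^sub>\<ge>\<^sub>0"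
proof -
  define c where "c = d \<circ> inv_into I x"
  have c: "c (x i) = d i" if "i \<in> I" for i using that I(2) by (simp add: c_def)
  have "(\<Sum>g\<in>x ` I. \<Sum>h\<in>x ` I. cnj (c g) * c h * \<phi> (inv\<^bsub>G\<^esub> g \<otimes>\<^bsub>G\<^esub> h)) \<in> \<real>\<^sub>\<ge>\<^sub>0"
    using pd I by (simp add: positive_definite_on_def)
  also have "(\<Sum>g\<in>x ` I. \<Sum>h\<in>x ` I. cnj (c g) * c h * \<phi> (inv\<^bsub>G\<^esub> g \<otimes>\<^bsub>G\<^esub> h))
     = (\<Sum>i\<in>I. \<Sum>j\<in>I. cnj (d i) * d j * \<phi> (inv\<^bsub>G\<^esub> (x i) \<otimes>\<^bsub>G\<^esub> x j))"
    by (simp add: sum.reindex[OF I(2)] c cong: sum.cong)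
  finally show ?thesis .
qed

text \<open>The function is the matrix coefficient of the vector \<open>\<alpha> \<gamma> \<xi> + \<beta> \<xi>\<close>. The elements \<open>\<tau> u \<gamma>\<close> and \<open>\<tau> u\<close> must be
  distinct because positive definiteness is stated for sums over sets.\<close>

lemma pos_def_Z2_coset_combination:
  fixes \<tau> :: "int \<times> int \<Rightarrow> 'a" and \<alpha> \<beta> :: real
  assumes G: "group G" and pd: "positive_definite_on G \<phi>"
    and \<tau>: "\<And>v. \<tau> v \<in> carrier G" "\<And>u v. \<tau> (u + v) = \<tau> u \<otimes>\<^bsub>G\<^esub> \<tau> v" "inj \<tau>"
    and \<gamma>: "\<gamma> \<in> carrier G" "\<gamma> \<notin> range \<tau>"
  shows "pos_def_Z2 (\<lambda>v. of_real (\<alpha>\<^sup>2) * \<phi> (inv\<^bsub>G\<^esub> \<gamma> \<otimes>\<^bsub>G\<^esub> \<tau> v \<otimes>\<^bsub>G\<^esub> \<gamma>) + of_real (\<beta>\<^sup>2) * \<phi> (\<tau> v)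
    + of_real (\<alpha> * \<beta>) * (\<phi> (inv\<^bsub>G\<^esub> \<gamma> \<otimes>\<^bsub>G\<^esub> \<tau> v) + \<phi> (\<tau> v \<otimes>\<^bsub>G\<^esub> \<gamma>)))"
    (is "pos_def_Z2 ?\<psi>")
  unfolding pos_def_Z2_def
proof (intro allI impI)
  interpret group G by fact
  fix F :: "(int \<times> int) set" and c :: "int \<times> int \<Rightarrow> complex" assume F: "finite F"
  \<comment> \<open>The Boolean records whether the translate belongs to the part with
    \<open>\<gamma>\<close>, weighted by \<open>\<alpha>\<close>, or to the part without it,
    weighted by \<open>\<beta>\<close>.\<close>
  define x where "x = (\<lambda>(u, b). \<tau> u \<otimes>\<^bsub>G\<^esub> (if b then \<gamma> else \<one>\<^bsub>G\<^esub>))"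
  define d where "d = (\<lambda>(u, b). c u * of_real (if b then \<alpha> else \<beta>))"
  have \<tau>0: "\<tau> 0 = \<one>\<^bsub>G\<^esub>"
    using \<tau>(2)[of 0 0] \<tau>(1)[of 0] by (metis add_0 l_cancel_one')
  have \<tau>m: "\<tau> (- u) = inv\<^bsub>G\<^esub> \<tau> u" for u
    using \<tau>(2)[of "- u" u] \<tau>0 \<tau>(1) by (metis add.left_inverse inv_equality)
  have n1: "\<tau> u \<noteq> \<tau> v \<otimes>\<^bsub>G\<^esub> \<gamma>" for u v
  proof
    assume "\<tau> u = \<tau> v \<otimes>\<^bsub>G\<^esub> \<gamma>"
    then have "\<gamma> = inv\<^bsub>G\<^esub> \<tau> v \<otimes>\<^bsub>G\<^esub> \<tau> u" using \<tau>(1) \<gamma>(1) by (metis inv_solve_left)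
    then have "\<gamma> = \<tau> (- v + u)" by (simp only: \<tau>(2) \<tau>m)
    then show False using \<gamma>(2) by blast
  qed
  have n2: "u = v" if "\<tau> u \<otimes>\<^bsub>G\<^esub> \<gamma> = \<tau> v \<otimes>\<^bsub>G\<^esub> \<gamma>" for u v
    using that \<tau> \<gamma>(1) by (metis right_cancel injD)
  have inj: "inj x"
  proof (rule injI)
    fix i j assume e: "x i = x j"
    obtain u a v b where "i = (u, a)" "j = (v, b)" by fastforce
    then show "i = j"
      using e n1[of u v] n1[of v u] n2[of u v] injD[OF \<tau>(3), of u v] \<tau>(1)
      by (cases a; cases b) (auto simp: x_def)
  qed
  have "(\<Sum>i\<in>F\<times>UNIV. \<Sum>j\<in>F\<times>UNIV. cnj (d i) * d j * \<phi> (inv\<^bsub>G\<^esub> (x i) \<otimes>\<^bsub>G\<^esub> x j)) \<in> \<real>\<^sub>\<ge>\<^sub>0"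
    by (rule positive_definite_on_family[OF pd])
      (use F \<tau>(1) \<gamma>(1) inj in \<open>auto simp: x_def intro: inj_on_subset\<close>)
  also have "(\<Sum>i\<in>F\<times>UNIV. \<Sum>j\<in>F\<times>UNIV. cnj (d i) * d j * \<phi> (inv\<^bsub>G\<^esub> (x i) \<otimes>\<^bsub>G\<^esub> x j))
    = (\<Sum>u\<in>F. \<Sum>a\<in>UNIV. \<Sum>v\<in>F. \<Sum>b\<in>UNIV. cnj (d (u, a)) * d (v, b) * \<phi> (inv\<^bsub>G\<^esub> (x (u, a)) \<otimes>\<^bsub>G\<^esub> x (v, b)))"
    by (simp only: sum.cartesian_product')
  also have "\<dots> = (\<Sum>u\<in>F. \<Sum>v\<in>F. \<Sum>a\<in>UNIV. \<Sum>b\<in>UNIV. cnj (d (u, a)) * d (v, b) * \<phi> (inv\<^bsub>G\<^esub> (x (u, a)) \<otimes>\<^bsub>G\<^esub> x (v, b)))"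
    by (intro sum.cong refl sum.swap)
  also have "\<dots> = (\<Sum>u\<in>F. \<Sum>v\<in>F. cnj (c u) * c v * ?\<psi> (v - u))"
  proof (intro sum.cong refl)
    fix u v
    have \<tau>d: "\<tau> (v - u) = inv\<^bsub>G\<^esub> \<tau> u \<otimes>\<^bsub>G\<^esub> \<tau> v"
      using \<tau>(2)[of "- u" v] by (simp add: \<tau>m)
    have "inv\<^bsub>G\<^esub> (\<tau> u \<otimes>\<^bsub>G\<^esub> \<gamma>) \<otimes>\<^bsub>G\<^esub> (\<tau> v \<otimes>\<^bsub>G\<^esub> \<gamma>) = inv\<^bsub>G\<^esub> \<gamma> \<otimes>\<^bsub>G\<^esub> \<tau> (v - u) \<otimes>\<^bsub>G\<^esub> \<gamma>"
      "inv\<^bsub>G\<^esub> (\<tau> u \<otimes>\<^bsub>G\<^esub> \<gamma>) \<otimes>\<^bsub>G\<^esub> \<tau> v = inv\<^bsub>G\<^esub> \<gamma> \<otimes>\<^bsub>G\<^esub> \<tau> (v - u)"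
      "inv\<^bsub>G\<^esub> \<tau> u \<otimes>\<^bsub>G\<^esub> (\<tau> v \<otimes>\<^bsub>G\<^esub> \<gamma>) = \<tau> (v - u) \<otimes>\<^bsub>G\<^esub> \<gamma>"
      using \<tau>(1) \<gamma>(1) by (simp_all add: \<tau>d inv_mult_group m_assoc)
    then show "(\<Sum>a\<in>UNIV. \<Sum>b\<in>UNIV. cnj (d (u, a)) * d (v, b) * \<phi> (inv\<^bsub>G\<^esub> (x (u, a)) \<otimes>\<^bsub>G\<^esub> x (v, b)))
       = cnj (c u) * c v * ?\<psi> (v - u)"
      using \<tau>(1) by (simp add: UNIV_bool x_def d_def \<tau>d[symmetric] algebra_simps power2_eq_square)
  qed
  finally show "(\<Sum>u\<in>F. \<Sum>v\<in>F. cnj (c u) * c v * ?\<psi> (v - u)) \<in> \<real>\<^sub>\<ge>\<^sub>0" .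
qed

lemma c0_on_bounded_index:
  assumes "c0_on S \<phi>" "\<And>k::int. x k \<in> S" "inj x" "\<epsilon> > 0"
  shows "\<exists>R>0. \<forall>k. int R \<le> \<bar>k\<bar> \<longrightarrow> cmod (\<phi> (x k)) \<le> \<epsilon>"
proof -
  have "finite (x -` {g \<in> S. cmod (\<phi> g) \<ge> \<epsilon>})"
    using assms by (intro finite_vimageI) (auto simp: c0_on_def)
  then have fin: "finite ((\<lambda>k. nat \<bar>k\<bar>) ` (x -` {g \<in> S. cmod (\<phi> g) \<ge> \<epsilon>}))" by simp
  then obtain R where R: "\<And>k. k \<in> x -` {g \<in> S. cmod (\<phi> g) \<ge> \<epsilon>} \<Longrightarrow> nat \<bar>k\<bar> < R"
    unfolding finite_nat_set_iff_bounded by blast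
  \<comment> \<open>\<open>Suc R\<close> rather than \<open>R\<close> makes the bound
    positive.\<close>
  have "cmod (\<phi> (x k)) \<le> \<epsilon>" if "int (Suc R) \<le> \<bar>k\<bar>" for k
    using R[of k] that assms(2)[of k] by force
  then show ?thesis by blast
qed

section \<open>Application to a nontrivial normal subgroup\<close>

theorem proposition2p9:
  shows "\<not> (\<exists>H. H \<lhd> (SL :: (int ^ 3 ^ 3) monoid)
    \<and> nontrivial_subgroup H (SL :: (int ^ 3 ^ 3) monoid)
    \<and> Haagerup_property ((SL :: (int ^ 3 ^ 3) monoid)\<lparr>carrier := H\<rparr>))"
proof
  assume "\<exists>H. H \<lhd> (SL :: (int ^ 3 ^ 3) monoid)
    \<and> nontrivial_subgroup H (SL :: (int ^ 3 ^ 3) monoid)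
    \<and> Haagerup_property ((SL :: (int ^ 3 ^ 3) monoid)\<lparr>carrier := H\<rparr>)"
  then obtain H :: "(int ^ 3 ^ 3) set" where H: "H \<lhd> SL" "nontrivial_subgroup H SL"
    and haag: "Haagerup_property (SL\<lparr>carrier := H\<rparr>)" by blast
  define G where "G = (SL :: (int ^ 3 ^ 3) monoid)\<lparr>carrier := H\<rparr>"
  interpret SL: group "SL :: (int ^ 3 ^ 3) monoid" by (rule SL3_group)
  have sub: "subgroup H SL" using H(2) by (simp add: nontrivial_subgroup_def)
  have G: "group G" unfolding G_def by (rule SL.subgroup_imp_group[OF sub])
  have carG: "carrier G = H" and multG: "x \<otimes>\<^bsub>G\<^esub> y = x ** y" for x y
    by (simp_all add: G_def SL_def)
  have invG: "inv\<^bsub>G\<^esub> x = inv\<^bsub>SL\<^esub> x" if "x \<in> H" for x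
    unfolding G_def by (rule SL.m_inv_consistent[OF sub that])
  obtain \<phi> where \<phi>: "\<And>i. positive_definite_on G (\<phi> i)" "\<And>i. c0_on H (\<phi> i)"
    "\<And>g. g \<in> H \<Longrightarrow> (\<lambda>i. \<phi> i g) \<longlonglongrightarrow> 1"
    using haag unfolding Haagerup_property_def G_def[symmetric] carG by blast
  have "mat 1 \<in> H" using subgroup.one_closed[OF sub] by (simp add: SL_one)
  then obtain g where "g \<in> H" "g \<noteq> mat 1"
    using H(2) by (auto simp: nontrivial_subgroup_def SL_one)
  then obtain n where n: "n \<noteq> 0" "transvection (n *s e1) e3 \<in> H"
    using nontrivial_transvection_mem[OF H(1)] e13_mem[OF H(1)] by meson
  \<comment> \<open>A multiple of \<open>n\<close>, so that \<open>elementary_mem\<close> applies;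
    positive whatever the sign of \<open>n\<close>, and at least 8 as the estimate for three
    translates requires.\<close>
  define N where "N = nat (8 * n * n)"
  have nn: "n * n \<ge> 1" using n(1) by (metis zero_less_mult_iff int_one_le_iff_zero_less linorder_neqE_linordered_idom)
  then have N: "int N = n * (8 * n)" and N8: "8 \<le> N" by (simp_all add: N_def)
  \<comment> \<open>The matrices that agree with the identity except for the third column
    \<open>(N p, N q, 1)\<close>.\<close>
  define \<tau> where "\<tau> = (\<lambda>(p, q). transvection (vector [int N * p, int N * q, 0] :: int ^ 3) e3)"
  have \<tau>H: "\<tau> v \<in> H" for v
  proof -
    obtain p q where v: "v = (p, q)" by force
    have "transvection ((n * (8 * n * p)) *s e1) e3 ** transvection ((n * (8 * n * q)) *s e2) e3 \<in> H"
      by (intro normal_SL_closed(1)[OF H(1)] elementary_mem[OF H(1) n(2)])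
    moreover have "(n * (8 * n * p)) *s e1 + (n * (8 * n * q)) *s e2 = (vector [int N * p, int N * q, 0] :: int ^ 3)"
      by (simp add: vec_eq_iff forall_3 e1_def e2_def N mult_ac)
    ultimately show ?thesis
      by (simp add: v \<tau>_def transvection_mult_same_row dot3_def e1_def e2_def e3_def)
  qed
  have \<tau>add: "\<tau> (u + v) = \<tau> u ** \<tau> v" for u v
  proof -
    obtain p q p' q' where uv: "u = (p, q)" "v = (p', q')" by fastforce
    have "(vector [int N * (p + p'), int N * (q + q'), 0] :: int ^ 3)
       = vector [int N * p, int N * q, 0] + vector [int N * p', int N * q', 0]"
      by (simp add: vec_eq_iff forall_3 algebra_simps)
    then show ?thesis
      by (simp add: uv \<tau>_def transvection_mult_same_row dot3_def e3_def)
  qed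
  have \<tau>entries: "\<tau> (p, q) $ 1 $ 3 = int N * p" "\<tau> (p, q) $ 2 $ 3 = int N * q"
    "\<tau> (p, q) $ 1 $ 2 = 0" "\<tau> (p, q) $ 2 $ 1 = 0" for p q
    by (simp_all add: \<tau>_def transvection_def outer_def mat_def e3_def)
  have \<tau>inj: "inj \<tau>"
  proof (rule injI)
    fix u v assume e: "\<tau> u = \<tau> v"
    obtain p q p' q' where uv: "u = (p, q)" "v = (p', q')" by fastforce
    show "u = v"
      using arg_cong[OF e, of "\<lambda>A. A $ 1 $ 3"] arg_cong[OF e, of "\<lambda>A. A $ 2 $ 3"] N8
      by (simp add: uv \<tau>entries)
  qed
  \<comment> \<open>Elementary matrices with entry \<open>k\<close> in position (2,1) and (1,2).
    Conjugation by them acts on the third column of \<open>\<tau> v\<close>, which yields the shears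
    of \<open>conj1\<close> and \<open>conj2\<close>.\<close>
  define \<gamma>1 \<gamma>2 where "\<gamma>1 = (\<lambda>k. transvection (k *s e2) e1)" and "\<gamma>2 = (\<lambda>k. transvection (k *s e1) e2)"
  have \<gamma>H: "\<gamma>1 k \<in> H" "\<gamma>2 k \<in> H" if "k \<in> {int N, - int N}" for k
    using that elementary_mem(3,4)[OF H(1) n(2), of "8 * n"] elementary_mem(3,4)[OF H(1) n(2), of "- (8 * n)"]
    by (auto simp: \<gamma>1_def \<gamma>2_def N)
  have \<gamma>inv: "inv\<^bsub>G\<^esub> \<gamma>1 k = \<gamma>1 (- k)" "inv\<^bsub>G\<^esub> \<gamma>2 k = \<gamma>2 (- k)" if "k \<in> {int N, - int N}" for k
    using \<gamma>H[OF that] inv_transvection[of e1 "k *s e2"] inv_transvection[of e2 "k *s e1"]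
    by (simp_all add: invG \<gamma>1_def \<gamma>2_def dot3_def e1_def e2_def vector_smult_lneg)
  have \<gamma>\<tau>: "\<gamma>1 k \<notin> range \<tau>" "\<gamma>2 k \<notin> range \<tau>" if "k \<in> {int N, - int N}" for k
  proof -
    have k: "k \<noteq> 0" using that N8 by auto
    show "\<gamma>1 k \<notin> range \<tau>"
    proof
      assume "\<gamma>1 k \<in> range \<tau>"
      then obtain p q where "\<gamma>1 k = \<tau> (p, q)" by auto
      from arg_cong[OF this, of "\<lambda>A. A $ 2 $ 1"] show False
        using k unfolding \<tau>entries by (simp add: \<gamma>1_def transvection_def outer_def mat_def e1_def e2_def)
    qed
    show "\<gamma>2 k \<notin> range \<tau>"
    proof
      assume "\<gamma>2 k \<in> range \<tau>"
      then obtain p q where "\<gamma>2 k = \<tau> (p, q)" by auto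
      from arg_cong[OF this, of "\<lambda>A. A $ 1 $ 2"] show False
        using k unfolding \<tau>entries by (simp add: \<gamma>2_def transvection_def outer_def mat_def e1_def e2_def)
    qed
  qed
  have conj1: "\<gamma>1 k ** \<tau> (p, q) ** \<gamma>1 (- k) = \<tau> (p, q + k * p)" for k p q
    by (simp add: \<gamma>1_def \<tau>_def conj_transvection transvection_vector vector_transvection transvection_inverse
        vector_smult_lneg dot3_def e1_def e2_def e3_def)
      (simp add: transvection_def outer_def vec_eq_iff forall_3 algebra_simps)
  have conj2: "\<gamma>2 k ** \<tau> (p, q) ** \<gamma>2 (- k) = \<tau> (p + k * q, q)" for k p q
    by (simp add: \<gamma>2_def \<tau>_def conj_transvection transvection_vector vector_transvection transvection_inverse
        vector_smult_lneg dot3_def e1_def e2_def e3_def)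
      (simp add: transvection_def outer_def vec_eq_iff forall_3 algebra_simps)
  define \<eta> where "\<eta> = 1 / (100000 * (real N)\<^sup>2)"
  have \<eta>0: "\<eta> > 0" using N8 by (simp add: \<eta>_def)
  \<comment> \<open>All the finitely many elements at which \<open>\<phi> i\<close> has to be close
    to 1.\<close>
  define S where "S = \<tau> ` {(0, 0), (1, 0), (-1, 0), (0, 1), (0, -1)} \<union> \<gamma>1 ` {int N, - int N} \<union> \<gamma>2 ` {int N, - int N}"
  have \<gamma>S: "\<gamma>1 k \<in> S" "\<gamma>2 k \<in> S" if "k \<in> {int N, - int N}" for k
    using that unfolding S_def by blast+
  have S: "finite S" "S \<subseteq> H" using \<tau>H \<gamma>H by (auto simp: S_def)
  have "\<forall>\<^sub>F i in sequentially. \<forall>g\<in>S. dist (\<phi> i g) 1 < \<eta>"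
    using S \<phi>(3) \<eta>0 by (intro eventually_ball_finite ballI tendstoD) auto
  then obtain i where i: "\<And>g. g \<in> S \<Longrightarrow> cmod (\<phi> i g - 1) \<le> \<eta>"
    unfolding eventually_sequentially dist_norm by (meson le_refl less_imp_le)
  define \<psi> where "\<psi> v = \<phi> i (\<tau> v)" for v
  have \<tau>0: "\<tau> 0 = mat 1"
    using \<tau>add[of 0 0] \<tau>entries[of 0 0] by (simp add: \<tau>_def zero_prod_def transvection_def outer_def vec_eq_iff forall_3)
  have pdc: "pos_def_Z2 (\<lambda>v. of_real (\<alpha>\<^sup>2) * \<phi> i (inv\<^bsub>G\<^esub> \<gamma> ** \<tau> v ** \<gamma>) + of_real (\<beta>\<^sup>2) * \<psi> v
      + of_real (\<alpha> * \<beta>) * (\<phi> i (inv\<^bsub>G\<^esub> \<gamma> ** \<tau> v) + \<phi> i (\<tau> v ** \<gamma>)))"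
    if "\<gamma> \<in> H" "\<gamma> \<notin> range \<tau>" for \<gamma> and \<alpha> \<beta> :: real
    unfolding \<psi>_def multG[symmetric]
    by (rule pos_def_Z2_coset_combination[OF G \<phi>(1)])
      (use that \<tau>H \<tau>add \<tau>inj in \<open>auto simp: carG multG\<close>)
  have \<kappa>: "cmod (\<phi> i g + \<phi> i h - 2) \<le> 2 * \<eta>" if "g \<in> S" "h \<in> S" for g h
    using norm_triangle_ineq[of "\<phi> i g - 1" "\<phi> i h - 1"] i[OF that(1)] i[OF that(2)] by simp
  show False
  proof (rule shear_invariant_pos_def_not_c0[OF N8 _ _ \<eta>_def])
    have k: "int N \<in> {int N, - int N}" by simp
    show "pos_def_Z2 \<psi>"
      using pdc[OF \<gamma>H(1)[OF k] \<gamma>\<tau>(1)[OF k], of 0 1] by simp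
    show "\<exists>R>0. \<forall>k. int R \<le> \<bar>k\<bar> \<longrightarrow> cmod (\<psi> (k, 0)) \<le> \<epsilon>" if "\<epsilon> > 0" for \<epsilon>
      unfolding \<psi>_def
      by (rule c0_on_bounded_index[OF \<phi>(2)]) (use \<tau>H \<tau>inj that in \<open>auto simp: inj_def\<close>)
    show "cmod (\<psi> v - 1) \<le> \<eta>" if "v \<in> {(0, 0), (1, 0), (-1, 0), (0, 1), (0, -1)}" for v
      unfolding \<psi>_def by (rule i) (use that in \<open>auto simp: S_def\<close>)
  next
    fix k assume k': "k \<in> {int N, - int N}"
    \<comment> \<open>The combination conjugates as
      \<open>inv \<gamma> ** \<tau> v ** \<gamma>\<close>, so the shear by \<open>k\<close> comes
      from the element with parameter \<open>- k\<close>, whose inverse has parameter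
      \<open>k\<close>.\<close>
    then have k: "- k \<in> {int N, - int N}" by auto
    show "\<exists>\<kappa>. cmod (\<kappa> 0 - 2) \<le> 2 * \<eta> \<and>
      (\<forall>\<alpha> \<beta> :: real. pos_def_Z2 (\<lambda>v. of_real (\<alpha>\<^sup>2) * (case v of (p, q) \<Rightarrow> \<psi> (p, q + k * p))
         + of_real (\<beta>\<^sup>2) * \<psi> v + of_real (\<alpha> * \<beta>) * \<kappa> v))"
    proof (intro exI[of _ "\<lambda>v. \<phi> i (\<gamma>1 k ** \<tau> v) + \<phi> i (\<tau> v ** \<gamma>1 (- k))"] conjI allI)
      show "cmod (\<phi> i (\<gamma>1 k ** \<tau> 0) + \<phi> i (\<tau> 0 ** \<gamma>1 (- k)) - 2) \<le> 2 * \<eta>"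
        unfolding \<tau>0 using k by (simp only: matrix_mul_lid matrix_mul_rid) (intro \<kappa> \<gamma>S k k')
      fix \<alpha> \<beta> :: real
      have "(case v of (p, q) \<Rightarrow> \<psi> (p, q + k * p)) = \<phi> i (\<gamma>1 k ** \<tau> v ** \<gamma>1 (- k))" for v
        by (cases v) (simp add: conj1 \<psi>_def)
      then show "pos_def_Z2 (\<lambda>v. of_real (\<alpha>\<^sup>2) * (case v of (p, q) \<Rightarrow> \<psi> (p, q + k * p))
         + of_real (\<beta>\<^sup>2) * \<psi> v + of_real (\<alpha> * \<beta>) * (\<phi> i (\<gamma>1 k ** \<tau> v) + \<phi> i (\<tau> v ** \<gamma>1 (- k))))"
        using pdc[OF \<gamma>H(1)[OF k] \<gamma>\<tau>(1)[OF k], of \<alpha> \<beta>] \<gamma>inv(1)[OF k] by simp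
    qed
    show "\<exists>\<kappa>. cmod (\<kappa> 0 - 2) \<le> 2 * \<eta> \<and>
      (\<forall>\<alpha> \<beta> :: real. pos_def_Z2 (\<lambda>v. of_real (\<alpha>\<^sup>2) * (case v of (p, q) \<Rightarrow> \<psi> (p + k * q, q))
         + of_real (\<beta>\<^sup>2) * \<psi> v + of_real (\<alpha> * \<beta>) * \<kappa> v))"
    proof (intro exI[of _ "\<lambda>v. \<phi> i (\<gamma>2 k ** \<tau> v) + \<phi> i (\<tau> v ** \<gamma>2 (- k))"] conjI allI)
      show "cmod (\<phi> i (\<gamma>2 k ** \<tau> 0) + \<phi> i (\<tau> 0 ** \<gamma>2 (- k)) - 2) \<le> 2 * \<eta>"
        unfolding \<tau>0 using k by (simp only: matrix_mul_lid matrix_mul_rid) (intro \<kappa> \<gamma>S k k')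
      fix \<alpha> \<beta> :: real
      have "(case v of (p, q) \<Rightarrow> \<psi> (p + k * q, q)) = \<phi> i (\<gamma>2 k ** \<tau> v ** \<gamma>2 (- k))" for v
        by (cases v) (simp add: conj2 \<psi>_def)
      then show "pos_def_Z2 (\<lambda>v. of_real (\<alpha>\<^sup>2) * (case v of (p, q) \<Rightarrow> \<psi> (p + k * q, q))
         + of_real (\<beta>\<^sup>2) * \<psi> v + of_real (\<alpha> * \<beta>) * (\<phi> i (\<gamma>2 k ** \<tau> v) + \<phi> i (\<tau> v ** \<gamma>2 (- k))))"
        using pdc[OF \<gamma>H(2)[OF k] \<gamma>\<tau>(2)[OF k], of \<alpha> \<beta>] \<gamma>inv(2)[OF k] by simp
    qed
  qed
qed

end
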